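(* For every instance of the joint job-emitting vehicle routing problem with time windows, the explicit formulation (EX) and the set-partitioning formulation (SP) are equivalent: (EX) is feasible if and only if (SP) is feasible, and the two have the same optimal value. Moreover, (SP) defines a tighter linear relaxation: for every instance, the optimal value of the linear relaxation of (SP) is at least the optimal value of the linear relaxation of (EX), and there are instances for which the inequality is strict. (The optimal value of an infeasible minimization problem is $+\infty$.)
   Context: **Instance.** Finite sets: jobs (job locations) $\mathcal I=\{1,\dots,I\}$; coverage locations $\mathcal J=\{1,\dots,J\}$; for each $i\in\mathcal I$ a subset $\mathcal C_i\subseteq\mathcal J$ of coverage locations that cover job $i$; time periods $\mathcal T=\{0,1,\dots,T+1\}$; mission vehicles $\mathcal U$ with $|\mathcal U|=U\ge 1$; emitting vehicles $\mathcal V$ with $|\mathcal V|=V\ge 1$. Each job $i$ has a positive integer workload $\tau_i$ and a time window given by integers $0\le T_i^S\le T_i^E\le T+1$. **Time-space networks.** Mission network: nodes $\mathcal N^M=\{(i,t): i\in\mathcal I,t\in\mathcal T\}$, together with start-depot nodes $(0,t)$ and end-depot nodes $(I+1,t)$, $t\in\mathcal T$. The arc set $\mathcal A^M$ consists of the idle arcs $((i,t),(i,t+1))$ for $i\in\mathcal I$, $t,t+1\in\mathcal T$, and of a finite set of travel arcs that join nodes at two different locations and go strictly forward in time. No arc enters a start-depot node and no arc leaves an end-depot node. The direct arc $((0,0),(I+1,T+1))$ of cost $0$ is included (trivial route of an unused vehicle). For a node $n$, $\mathcal A^{M,-}_n$ and $\mathcal A^{M,+}_n$ are the sets of arcs incoming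 to and outgoing from $n$. Each arc $a\in\mathcal A^M$ has a cost (distance) $c^M_a\ge 0$. The emitting network (nodes $\mathcal N^E=\{(j,t):j\in\mathcal J,t\in\mathcal T\}$, depot nodes $(0,t)$ and $(J+1,t)$, arcs $\mathcal A^E$, sets $\mathcal A^{E,\pm}_n$, costs $c^E_a\ge 0$) is defined in the same way with $\mathcal J$ in place of $\mathcal I$. Write $e^M_{i,t}=((i,t),(i,t+1))$ and $e^E_{j,t}=((j,t),(j,t+1))$ for idle arcs; terms involving idle arcs that do not exist ($t=T+1$) are omitted from sums. **Explicit formulation (EX).** Binary variables $z_{ua}$ ($u\in\mathcal U,a\in\mathcal A^M$), $x_{va}$ ($v\in\mathcal V,a\in\mathcal A^E$), $y^S_{it},y^E_{it}$ ($i\in\mathcal I,t\in\mathcal T$; job $i$ has started, respectively ended, by time $t$). Minimize $$\sum_{u}\sum_{a\in\mathcal A^M}c^M_az_{ua}+\sum_v\sum_{a\in\mathcal A^E}c^E_ax_{va}$$ subject to: - for all $u$: $\sum_{t}\sum_{a\in\mathcal A^{M,+}_{(0,t)}}z_{ua}=1$, $\ \sum_{t}\sum_{a\in\mathcal A^{M,-}_{(I+1,t)}}z_{ua}=1$, and $\sum_{a\in\mathcal A^{M,-}_n}z_{ua}=\sum_{a\in\mathcal A^{M,+}_n}z_{ua}$ for all $n\in\mathcal N^M$; - for all $i\in\mathcal I$: $\sum_u\sum_t\sum_{a}z_{ua}=1$, where $a$ ranges over the non-idle (travel) arcs in $\mathcal A^{M,-}_{(i,t)}$; - for all $v$: $\sum_{t}\sum_{a\in\mathcal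 A^{E,+}_{(0,t)}}x_{va}=1$, $\ \sum_{t}\sum_{a\in\mathcal A^{E,-}_{(J+1,t)}}x_{va}=1$, and $\sum_{a\in\mathcal A^{E,-}_n}x_{va}=\sum_{a\in\mathcal A^{E,+}_n}x_{va}$ for all $n\in\mathcal N^E$; - for all $i$: $y^S_{it}\le y^S_{i,t+1}$ and $y^E_{it}\le y^E_{i,t+1}$ whenever $t,t+1\in\mathcal T$; $y^S_{it}=0$ for $t<T_i^S$; $y^E_{it}=1$ for $t\ge T_i^E$; $\sum_{t\in\mathcal T}(y^S_{it}-y^E_{it})\ge\tau_i$; - for all $i\in\mathcal I,t\in\mathcal T$: $y^S_{it}-y^E_{it}\le\sum_u z_{u,e^M_{i,t}}$ and $y^S_{it}-y^E_{it}\le\sum_v\sum_{j\in\mathcal C_i}x_{v,e^E_{j,t}}$. The linear relaxation of (EX) replaces binarity by the bounds $[0,1]$. **Set-partitioning formulation (SP).** $\mathcal Q$ is the set of all mission paths. A mission path $q$ is a directed path in the mission network from a start-depot node to an end-depot node that enters each job location by a travel arc at most once, together with, for each job $i$ whose location it visits, a set of consecutive time periods in which it performs work on $i$; this set contains at least $\tau_i$ periods, is contained in $\{T_i^S,\dots,T_i^E-1\}$, and each of its periods $t$ is such that $q$ uses the idle arc $e^M_{i,t}$. Put $\delta^q_{it}=1$ if $q$ performs work on job $i$ in period $t$ and $\delta^q_{it}=0$ otherwise. $\mathcal Q_i\subseteq\mathcal Q$ is the set of mission paths that visit job $i$. $\mathcal P$ is the set of all emitting paths, i.e. directed paths in the emitting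 network from a start-depot node to an end-depot node; $g^p_{it}=1$ if $p$ uses the idle arc $e^E_{j,t}$ for some $j\in\mathcal C_i$, and $g^p_{it}=0$ otherwise. Path costs $\overline c^M_q,\overline c^E_p$ are the sums of the costs of the arcs of the path. The formulation is $$\min\ \sum_{q\in\mathcal Q}\overline c^M_q\overline z_q+\sum_{p\in\mathcal P}\overline c^E_p\overline x_p$$ subject to $\sum_{q\in\mathcal Q_i}\overline z_q=1$ for all $i\in\mathcal I$; $\ \sum_{q\in\mathcal Q}\overline z_q\le U$; $\ \sum_{p\in\mathcal P}\overline x_p\le V$; $\ \sum_{q\in\mathcal Q}\delta^q_{it}\overline z_q\le\sum_{p\in\mathcal P}g^p_{it}\overline x_p$ for all $i\in\mathcal I,t\in\mathcal T$; and $\overline z_q,\overline x_p\in\{0,1\}$. The linear relaxation of (SP) replaces the last condition by $\overline z_q,\overline x_p\ge 0$. *)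

theory Defs
  imports "Graph_Theory.Pair_Digraph" "HOL-Library.Extended_Real"
begin

section \<open>Time-space networks\<close>

text \<open>
  A node is a pair of a location and a time period. With \<open>L\<close> proper locations, location \<open>0\<close> is the
  start depot, locations \<open>1, \<dots>, L\<close> are the job (or coverage) locations, and location \<open>L + 1\<close> is
  the end depot. The parameter \<open>T\<close> stands for the time periods \<open>0, \<dots>, T + 1\<close>.
\<close>

type_synonym node = "nat \<times> nat"
type_synonym tsarc = "node \<times> node"

record tsnet =
  nlocs :: nat
  travel :: "tsarc set"
  acost :: "tsarc \<Rightarrow> real"

definition locations :: "tsnet \<Rightarrow> nat set" where
  "locations N = {1..nlocs N}"

definition periods :: "nat \<Rightarrow> nat set" where
  "periods T = {0..T + 1}"

definition idle :: "nat \<Rightarrow> nat \<Rightarrow> tsarc" where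
  "idle i t = ((i, t), (i, t + 1))"

definition direct_arc :: "nat \<Rightarrow> tsnet \<Rightarrow> tsarc" where
  "direct_arc T N = ((0, 0), (nlocs N + 1, T + 1))"

definition network :: "nat \<Rightarrow> tsnet \<Rightarrow> (node, tsarc) pre_digraph" where
  "network T N = with_proj
     \<lparr> pverts = {0..nlocs N + 1} \<times> periods T,
       parcs = {idle i t |i t. i \<in> locations N \<and> t \<in> periods T \<and> t + 1 \<in> periods T} \<union> travel N \<rparr>"

definition valid_tsnet :: "nat \<Rightarrow> tsnet \<Rightarrow> bool" where
  "valid_tsnet T N \<longleftrightarrow>
     (\<forall>((k, s), (l, t)) \<in> travel N.
        k \<in> {0..nlocs N + 1} \<and> l \<in> {0..nlocs N + 1} \<and> s \<in> periods T \<and> t \<in> periods T \<and>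
        k \<noteq> l \<and> s < t \<and> l \<noteq> 0 \<and> k \<noteq> nlocs N + 1) \<and>
     direct_arc T N \<in> travel N \<and> acost N (direct_arc T N) = 0 \<and>
     (\<forall>a \<in> arcs (network T N). acost N a \<ge> 0)"

definition depot_path :: "nat \<Rightarrow> tsnet \<Rightarrow> tsarc list \<Rightarrow> bool" where
  "depot_path T N p \<longleftrightarrow>
     (\<exists>s \<in> periods T. \<exists>t \<in> periods T. pre_digraph.apath (network T N) (0, s) p (nlocs N + 1, t))"

definition path_cost :: "tsnet \<Rightarrow> tsarc list \<Rightarrow> real" where
  "path_cost N p = (\<Sum>a\<leftarrow>p. acost N a)"

text \<open>
  The flow constraints of one vehicle; \<open>D\<close> is the domain of the variables: \<open>{0, 1}\<close> in the integer
  program, \<open>{0..1}\<close> in its linear relaxation.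
\<close>

definition vehicle_flow :: "real set \<Rightarrow> nat \<Rightarrow> tsnet \<Rightarrow> (tsarc \<Rightarrow> real) \<Rightarrow> bool" where
  "vehicle_flow D T N w \<longleftrightarrow>
     (\<forall>a \<in> arcs (network T N). w a \<in> D) \<and>
     (\<Sum>t \<in> periods T. \<Sum>a \<in> out_arcs (network T N) (0, t). w a) = 1 \<and>
     (\<Sum>t \<in> periods T. \<Sum>a \<in> in_arcs (network T N) (nlocs N + 1, t). w a) = 1 \<and>
     (\<forall>n \<in> locations N \<times> periods T.
        (\<Sum>a \<in> in_arcs (network T N) n. w a) = (\<Sum>a \<in> out_arcs (network T N) n. w a))"


section \<open>Instances\<close>

record jevrp =
  horizon :: nat
  mission :: tsnet
  emitting :: tsnet
  covers :: "nat \<Rightarrow> nat set"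
  nmission :: nat
  nemitting :: nat
  workload :: "nat \<Rightarrow> nat"
  wstart :: "nat \<Rightarrow> nat"
  wend :: "nat \<Rightarrow> nat"

abbreviation jobs :: "jevrp \<Rightarrow> nat set" where
  "jobs P \<equiv> locations (mission P)"

abbreviation tperiods :: "jevrp \<Rightarrow> nat set" where
  "tperiods P \<equiv> periods (horizon P)"

abbreviation mnet :: "jevrp \<Rightarrow> (node, tsarc) pre_digraph" where
  "mnet P \<equiv> network (horizon P) (mission P)"

abbreviation enet :: "jevrp \<Rightarrow> (node, tsarc) pre_digraph" where
  "enet P \<equiv> network (horizon P) (emitting P)"

definition valid_instance :: "jevrp \<Rightarrow> bool" where
  "valid_instance P \<longleftrightarrow>
     valid_tsnet (horizon P) (mission P) \<and> valid_tsnet (horizon P) (emitting P) \<and>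
     nmission P \<ge> 1 \<and> nemitting P \<ge> 1 \<and>
     (\<forall>i \<in> jobs P. covers P i \<subseteq> locations (emitting P) \<and> workload P i > 0 \<and>
        wstart P i \<le> wend P i \<and> wend P i \<le> horizon P + 1)"

definition opt_value :: "'a set \<Rightarrow> ('a \<Rightarrow> real) \<Rightarrow> ereal" where
  "opt_value F c = (INF s \<in> F. ereal (c s))"


section \<open>Explicit formulation\<close>

record ex_point =
  zvar :: "nat \<Rightarrow> tsarc \<Rightarrow> real"
  xvar :: "nat \<Rightarrow> tsarc \<Rightarrow> real"
  ySvar :: "nat \<Rightarrow> nat \<Rightarrow> real"
  yEvar :: "nat \<Rightarrow> nat \<Rightarrow> real"

definition idle_val :: "jevrp \<Rightarrow> (tsarc \<Rightarrow> real) \<Rightarrow> nat \<Rightarrow> nat \<Rightarrow> real" where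
  \<comment> \<open>there is no idle arc out of the last period; its term is omitted\<close>
  "idle_val P w l t = (if t + 1 \<in> tperiods P then w (idle l t) else 0)"

definition ex_feasible :: "real set \<Rightarrow> jevrp \<Rightarrow> ex_point set" where
  "ex_feasible D P = {s.
     (\<forall>u \<in> {1..nmission P}. vehicle_flow D (horizon P) (mission P) (zvar s u)) \<and>
     (\<forall>v \<in> {1..nemitting P}. vehicle_flow D (horizon P) (emitting P) (xvar s v)) \<and>
     (\<forall>i \<in> jobs P. (\<Sum>u \<in> {1..nmission P}. \<Sum>t \<in> tperiods P.
        \<Sum>a \<in> in_arcs (mnet P) (i, t) \<inter> travel (mission P). zvar s u a) = 1) \<and>
     (\<forall>i \<in> jobs P.
        (\<forall>t \<in> tperiods P. ySvar s i t \<in> D \<and> yEvar s i t \<in> D) \<and>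
        (\<forall>t \<in> tperiods P. t + 1 \<in> tperiods P \<longrightarrow>
           ySvar s i t \<le> ySvar s i (t + 1) \<and> yEvar s i t \<le> yEvar s i (t + 1)) \<and>
        (\<forall>t \<in> tperiods P. t < wstart P i \<longrightarrow> ySvar s i t = 0) \<and>
        (\<forall>t \<in> tperiods P. t \<ge> wend P i \<longrightarrow> yEvar s i t = 1) \<and>
        (\<Sum>t \<in> tperiods P. ySvar s i t - yEvar s i t) \<ge> real (workload P i)) \<and>
     (\<forall>i \<in> jobs P. \<forall>t \<in> tperiods P.
        ySvar s i t - yEvar s i t \<le> (\<Sum>u \<in> {1..nmission P}. idle_val P (zvar s u) i t) \<and>
        ySvar s i t - yEvar s i t
          \<le> (\<Sum>v \<in> {1..nemitting P}. \<Sum>j \<in> covers P i. idle_val P (xvar s v) j t))}"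

definition ex_cost :: "jevrp \<Rightarrow> ex_point \<Rightarrow> real" where
  "ex_cost P s =
     (\<Sum>u \<in> {1..nmission P}. \<Sum>a \<in> arcs (mnet P). acost (mission P) a * zvar s u a) +
     (\<Sum>v \<in> {1..nemitting P}. \<Sum>a \<in> arcs (enet P). acost (emitting P) a * xvar s v a)"

abbreviation EX_IP :: "jevrp \<Rightarrow> ex_point set" where
  "EX_IP \<equiv> ex_feasible {0, 1}"

abbreviation EX_LP :: "jevrp \<Rightarrow> ex_point set" where
  "EX_LP \<equiv> ex_feasible {0..1}"


section \<open>Set-partitioning formulation\<close>

text \<open>
  A mission path is a pair of the arc list of the route and the set of all pairs \<open>(i, t)\<close> such that
  work is performed on job \<open>i\<close> in period \<open>t\<close>.
\<close>

type_synonym mpath = "tsarc list \<times> (nat \<times> nat) set"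

definition visits :: "tsarc list \<Rightarrow> nat \<Rightarrow> bool" where
  \<comment> \<open>routes begin at the start depot, so every visited job node is the head of some arc\<close>
  "visits p i \<longleftrightarrow> (\<exists>a \<in> set p. fst (snd a) = i)"

definition mission_paths :: "jevrp \<Rightarrow> mpath set" where
  "mission_paths P = {(p, W).
     depot_path (horizon P) (mission P) p \<and>
     (\<forall>i \<in> jobs P. card {a \<in> set p. a \<in> travel (mission P) \<and> fst (snd a) = i} \<le> 1) \<and>
     W \<subseteq> {i \<in> jobs P. visits p i} \<times> UNIV \<and>
     (\<forall>i \<in> jobs P. visits p i \<longrightarrow>
        (\<exists>s e. W `` {i} = {s..<e}) \<and>
        card (W `` {i}) \<ge> workload P i \<and>
        W `` {i} \<subseteq> {wstart P i..<wend P i} \<and>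
        (\<forall>t \<in> W `` {i}. idle i t \<in> set p))}"

definition mission_paths_of :: "jevrp \<Rightarrow> nat \<Rightarrow> mpath set" where
  "mission_paths_of P i = {q \<in> mission_paths P. visits (fst q) i}"

definition emitting_paths :: "jevrp \<Rightarrow> tsarc list set" where
  "emitting_paths P = {p. depot_path (horizon P) (emitting P) p}"

definition delta :: "mpath \<Rightarrow> nat \<Rightarrow> nat \<Rightarrow> real" where
  "delta q i t = (if (i, t) \<in> snd q then 1 else 0)"

definition gcov :: "jevrp \<Rightarrow> tsarc list \<Rightarrow> nat \<Rightarrow> nat \<Rightarrow> real" where
  "gcov P p i t = (if \<exists>j \<in> covers P i. idle j t \<in> set p then 1 else 0)"

record sp_point =
  zbar :: "mpath \<Rightarrow> real"
  xbar :: "tsarc list \<Rightarrow> real"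

definition sp_feasible :: "real set \<Rightarrow> jevrp \<Rightarrow> sp_point set" where
  "sp_feasible D P = {s.
     (\<forall>q \<in> mission_paths P. zbar s q \<in> D) \<and>
     (\<forall>p \<in> emitting_paths P. xbar s p \<in> D) \<and>
     (\<forall>i \<in> jobs P. (\<Sum>q \<in> mission_paths_of P i. zbar s q) = 1) \<and>
     (\<Sum>q \<in> mission_paths P. zbar s q) \<le> real (nmission P) \<and>
     (\<Sum>p \<in> emitting_paths P. xbar s p) \<le> real (nemitting P) \<and>
     (\<forall>i \<in> jobs P. \<forall>t \<in> tperiods P.
        (\<Sum>q \<in> mission_paths P. delta q i t * zbar s q)
          \<le> (\<Sum>p \<in> emitting_paths P. gcov P p i t * xbar s p))}"

definition sp_cost :: "jevrp \<Rightarrow> sp_point \<Rightarrow> real" where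
  "sp_cost P s =
     (\<Sum>q \<in> mission_paths P. path_cost (mission P) (fst q) * zbar s q) +
     (\<Sum>p \<in> emitting_paths P. path_cost (emitting P) p * xbar s p)"

abbreviation SP_IP :: "jevrp \<Rightarrow> sp_point set" where
  "SP_IP \<equiv> sp_feasible {0, 1}"

abbreviation SP_LP :: "jevrp \<Rightarrow> sp_point set" where
  "SP_LP \<equiv> sp_feasible {0..}"


section \<open>Finiteness of the index sets of the sums\<close>

lemma fin_digraph_network:
  assumes "valid_tsnet T N"
  shows "fin_digraph (network T N)"
proof -
  let ?V = "{0..nlocs N + 1} \<times> periods T"
  have sub: "arcs (network T N) \<subseteq> ?V \<times> ?V"
    using assms
    by (auto simp: network_def idle_def locations_def periods_def valid_tsnet_def)
  have ends: "tail (network T N) = fst" "head (network T N) = snd" "verts (network T N) = ?V"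
    by (simp_all add: network_def)
  have "finite ?V" by (simp add: periods_def)
  then show ?thesis
    using sub finite_subset[OF sub] by unfold_locales (auto simp: ends)
qed

lemma finite_depot_paths:
  assumes "valid_tsnet T N"
  shows "finite {p. depot_path T N p}"
proof -
  interpret fin_digraph "network T N" by (rule fin_digraph_network[OF assms])
  have "{p. depot_path T N p} =
      (\<Union>s \<in> periods T. \<Union>t \<in> periods T. {p. apath (0, s) p (nlocs N + 1, t)})"
    by (auto simp: depot_path_def)
  then show ?thesis by (simp add: periods_def apaths_finite)
qed

lemma finite_emitting_paths: "valid_instance P \<Longrightarrow> finite (emitting_paths P)"
  by (simp add: emitting_paths_def valid_instance_def finite_depot_paths)

lemma finite_mission_paths:
  assumes "valid_instance P"
  shows "finite (mission_paths P)"
proof (rule finite_subset)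
  show "mission_paths P \<subseteq>
    {p. depot_path (horizon P) (mission P) p} \<times> Pow (jobs P \<times> {..<horizon P + 1})"
  proof (rule subrelI)
    fix p W assume m: "(p, W) \<in> mission_paths P"
    have "W \<subseteq> jobs P \<times> {..<horizon P + 1}"
    proof (rule subrelI)
      fix i t assume w: "(i, t) \<in> W"
      then have i: "i \<in> jobs P" "visits p i" using m by (auto simp: mission_paths_def)
      then have "W `` {i} \<subseteq> {wstart P i..<wend P i}" using m by (auto simp: mission_paths_def)
      then have "t < wend P i" using w by auto
      then show "(i, t) \<in> jobs P \<times> {..<horizon P + 1}"
        using assms i by (auto simp: valid_instance_def)
    qed
    then show "(p, W) \<in> {p. depot_path (horizon P) (mission P) p} \<times> Pow (jobs P \<times> {..<horizon P + 1})"
      using m by (auto simp: mission_paths_def)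
  qed
  show "finite ({p. depot_path (horizon P) (mission P) p} \<times> Pow (jobs P \<times> {..<horizon P + 1}))"
    using assms by (simp add: valid_instance_def finite_depot_paths locations_def)
qed

end

theory Submission
  imports Defs
begin

text \<open>
  Both networks are acyclic, so a binary unit flow is the indicator of a single depot-to-depot path; an
  integral solution of (EX) therefore yields one path per vehicle, the work on job \<open>i\<close> being done
  in the periods with \<open>y\<^sup>S = 1\<close> and \<open>y\<^sup>E = 0\<close>, which form an interval.
  Conversely, path weights, binary or fractional, are distributed over the vehicles so that each vehicle
  carries a convex combination of paths; \<open>y\<^sup>S\<close> and \<open>y\<^sup>E\<close> are the total weights of
  the paths that have begun, respectively completed, their work on the job. The same construction serves
  the integer programs and the relaxations.
\<close>

section \<open>Paths and flows in a time-space network\<close>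

text \<open>The two formulations count vehicles differently. (EX) gives every vehicle exactly one
  unit of flow, while (SP) only bounds the number of paths, so the free direct route has to absorb
  the slack. Its weight is the one quantity that the translation from (SP) does not preserve, which
  is harmless because it touches no job entry, no idle arc and no cost. In the other direction two
  vehicles may follow the same path, whereas a binary path variable counts it once. The cost may
  then drop; since costs are nonnegative this gives an inequality in the useful direction, and
  together with the exact translation from (SP) it still yields equal optimal values. The gap
  between the relaxations comes from the columns: a mission path that visits a job carries the full
  workload of that job on one route. In the example this makes the relaxed (SP) infeasible, so the
  gap lies between a finite value and infinity, and all costs can be zero.\<close>

definition path_flow :: "tsarc list \<Rightarrow> tsarc \<Rightarrow> real" where
  "path_flow p a = of_bool (a \<in> set p)"

definition entry_arcs :: "tsnet \<Rightarrow> nat \<Rightarrow> tsarc set" where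
  "entry_arcs N i = {a \<in> travel N. fst (snd a) = i}"

lemma head_network [simp]: "head (network T N) = snd"
  and tail_network [simp]: "tail (network T N) = fst"
  and verts_network: "verts (network T N) = {0..nlocs N + 1} \<times> periods T"
  and arcs_network: "arcs (network T N) =
    {idle i t |i t. i \<in> locations N \<and> t \<in> periods T \<and> t + 1 \<in> periods T} \<union> travel N"
  by (simp_all add: network_def)

lemma finite_locations [simp]: "finite (locations N)"
  and finite_periods [simp]: "finite (periods T)"
  by (simp_all add: locations_def periods_def)

lemma in_locations_iff: "l \<in> locations N \<longleftrightarrow> 1 \<le> l \<and> l \<le> nlocs N"
  by (auto simp: locations_def)

lemma vehicle_flowD:
  assumes "vehicle_flow D T N w"
  shows "a \<in> arcs (network T N) \<Longrightarrow> w a \<in> D"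
    "(\<Sum>t \<in> periods T. \<Sum>a \<in> out_arcs (network T N) (0, t). w a) = 1"
    "(\<Sum>t \<in> periods T. \<Sum>a \<in> in_arcs (network T N) (nlocs N + 1, t). w a) = 1"
    "n \<in> locations N \<times> periods T \<Longrightarrow>
      sum w (in_arcs (network T N) n) = sum w (out_arcs (network T N) n)"
  using assms unfolding vehicle_flow_def by blast+

lemma sum_pos_obtain:
  fixes f :: "'a \<Rightarrow> real"
  assumes "0 < sum f A"
  obtains a where "a \<in> A" "0 < f a"
  using assms sum_nonpos[of A f] by (force simp: not_less[symmetric])

locale ts_network =
  fixes T :: nat and N :: tsnet
  assumes valid: "valid_tsnet T N"
begin

abbreviation "G \<equiv> network T N"

sublocale fin_digraph G
  by (rule fin_digraph_network[OF valid])

section \<open>Arcs of a valid network\<close>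

lemma travelD:
  assumes "a \<in> travel N"
  shows "fst (fst a) \<noteq> fst (snd a)" "snd (fst a) < snd (snd a)"
    "fst (snd a) \<noteq> 0" "fst (fst a) \<noteq> nlocs N + 1"
    "fst (fst a) \<le> nlocs N + 1" "fst (snd a) \<le> nlocs N + 1"
    "snd (fst a) \<in> periods T" "snd (snd a) \<in> periods T"
  using assms valid by (cases a; force simp: valid_tsnet_def)+

lemma arcD:
  assumes "a \<in> arcs G"
  shows "snd (fst a) < snd (snd a)" "fst (snd a) \<noteq> 0" "fst (fst a) \<noteq> nlocs N + 1"
    "fst (fst a) \<le> nlocs N + 1" "fst (snd a) \<le> nlocs N + 1"
    "snd (fst a) \<in> periods T" "snd (snd a) \<in> periods T"
  using assms travelD[of a] by (auto simp: arcs_network idle_def in_locations_iff)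

lemma travel_subset_arcs: "travel N \<subseteq> arcs G"
  by (auto simp: arcs_network)

lemma idle_notin_travel: "idle i t \<notin> travel N"
  using travelD(1)[of "idle i t"] by (auto simp: idle_def)

lemma idle_in_arcs_iff:
  "idle i t \<in> arcs G \<longleftrightarrow> i \<in> locations N \<and> t \<in> periods T \<and> t + 1 \<in> periods T"
  using idle_notin_travel[of i t] by (auto simp: arcs_network) (auto simp: idle_def)

lemma nontravel_arc:
  assumes "a \<in> arcs G" "a \<notin> travel N"
  shows "a = idle (fst (snd a)) (snd (fst a))"
  using assms by (auto simp: arcs_network idle_def)

lemma direct_arc_travel: "direct_arc T N \<in> travel N"
  and cost_direct_arc [simp]: "acost N (direct_arc T N) = 0"
  and cost_nonneg: "a \<in> arcs G \<Longrightarrow> acost N a \<ge> 0"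
  using valid by (auto simp: valid_tsnet_def)

lemma entry_arcs_subset: "entry_arcs N i \<subseteq> arcs G"
  using travel_subset_arcs by (auto simp: entry_arcs_def)

lemma finite_entry_arcs [simp]: "finite (entry_arcs N i)"
  using entry_arcs_subset finite_arcs by (rule finite_subset)

text \<open>Every arc has a single head, so the inner sets for different periods are disjoint. This
  turns the visit constraint of (EX) into a sum over one arc set.\<close>

lemma sum_entry_arcs:
  "(\<Sum>t \<in> periods T. \<Sum>a \<in> in_arcs G (i, t) \<inter> travel N. f a) = (\<Sum>a \<in> entry_arcs N i. f a)"
proof -
  have "entry_arcs N i = (\<Union>t \<in> periods T. in_arcs G (i, t) \<inter> travel N)"
    using travelD travel_subset_arcs by (auto simp: entry_arcs_def in_arcs_def)
  then show ?thesis
    by (simp only:) (subst sum.UNION_disjoint, auto)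
qed

text \<open>Each passage through \<open>n\<close> uses one arc in and one arc out, the ends of the
  walk being the only exceptions. Counting with multiplicity keeps the induction free of a
  distinctness condition.\<close>

lemma cas_count_balance:
  assumes "cas u p v" "set p \<subseteq> arcs G"
  shows "(\<Sum>a \<in> out_arcs G n. count_list p a) + of_bool (n = v) =
    (\<Sum>a \<in> in_arcs G n. count_list p a) + of_bool (n = u)"
  using assms
proof (induction p arbitrary: u)
  case (Cons e p)
  have *: "(\<Sum>a \<in> A. count_list (e # p) a) = of_bool (e \<in> A) + (\<Sum>a \<in> A. count_list p a)"
    if "finite A" for A
  proof -
    have "(\<Sum>a \<in> A. count_list (e # p) a) = (\<Sum>a \<in> A. (if e = a then 1 else 0) + count_list p a)"
      by (intro sum.cong) auto
    then show ?thesis using that by (simp add: sum.distrib)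
  qed
  from Cons have "cas (snd e) p v" "fst e = u" "e \<in> arcs G" "set p \<subseteq> arcs G" by auto
  with Cons.IH[of "snd e"] show ?case
    by (simp only: * finite_in_arcs finite_out_arcs) auto
qed auto

lemma cas_time_mono:
  assumes "cas u p v" "set p \<subseteq> arcs G" "n \<in> set (awalk_verts u p)"
  shows "snd u \<le> snd n"
  using assms
proof (induction p arbitrary: u)
  case (Cons e p)
  then have "snd u < snd (snd e)" using arcD[of e] by auto
  moreover have "n = u \<or> snd (snd e) \<le> snd n"
    using Cons.IH[of "snd e"] Cons.prems by auto
  ultimately show ?case by auto
qed auto

text \<open>Arcs go strictly forward in time, so a walk never returns to a node.\<close>

lemma cas_distinct_verts:
  assumes "cas u p v" "set p \<subseteq> arcs G"
  shows "distinct (awalk_verts u p)"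
  using assms
proof (induction p arbitrary: u)
  case (Cons e p)
  have "u \<notin> set (awalk_verts (snd e) p)"
    using cas_time_mono[of "snd e" p v u] arcD(1)[of e] Cons.prems by auto
  with Cons show ?case by auto
qed auto

text \<open>The simplicity demanded by \<open>apath\<close> is automatic here, so any connected arc
  sequence between the depots is a route.\<close>

lemma depot_path_iff:
  "depot_path T N p \<longleftrightarrow> set p \<subseteq> arcs G \<and>
     (\<exists>s \<in> periods T. \<exists>t \<in> periods T. cas (0, s) p (nlocs N + 1, t))"
  using cas_distinct_verts
  by (auto simp: depot_path_def apath_def awalk_def verts_network)

lemma depot_pathD:
  assumes "depot_path T N p"
  shows "distinct p" "set p \<subseteq> arcs G"
  using assms
  by (auto simp: depot_path_def apath_def awalk_def intro: distinct_verts_imp_distinct)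

lemma path_flow_balance:
  assumes "cas u p v" "set p \<subseteq> arcs G" "distinct p"
  shows "(\<Sum>a \<in> out_arcs G n. path_flow p a) + of_bool (n = v) =
    (\<Sum>a \<in> in_arcs G n. path_flow p a) + of_bool (n = u)"
proof -
  have c: "path_flow p a = real (count_list p a)" for a
    using assms(3) by (induction p) (auto simp: path_flow_def)
  show ?thesis
    unfolding c using arg_cong[OF cas_count_balance[OF assms(1,2), of n], of real] by simp
qed


lemma in_arcs_start [simp]: "in_arcs G (0, t) = {}"
  and out_arcs_end [simp]: "out_arcs G (nlocs N + 1, t) = {}"
  by (auto simp: in_arcs_def out_arcs_def dest: arcD(2,3))

lemma depot_path_flow:
  assumes "depot_path T N p"
  shows "vehicle_flow {0, 1} T N (path_flow p)"
proof -
  from assms obtain s t where st: "s \<in> periods T" "t \<in> periods T" "cas (0, s) p (nlocs N + 1, t)"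
    and p: "set p \<subseteq> arcs G"
    by (auto simp: depot_path_iff)
  note balance = path_flow_balance[OF st(3) p depot_pathD(1)[OF assms]]
  \<comment> \<open>Nothing enters a start node, so the balance equation turns its outflow into the
    indicator of the departure time \<open>s\<close>.\<close>
  have "(\<Sum>r \<in> periods T. \<Sum>a \<in> out_arcs G (0, r). path_flow p a) = (\<Sum>r \<in> periods T. of_bool (r = s))"
    using balance[of "(0, _)"] by (intro sum.cong) auto
  moreover have "(\<Sum>r \<in> periods T. \<Sum>a \<in> in_arcs G (nlocs N + 1, r). path_flow p a) =
      (\<Sum>r \<in> periods T. of_bool (r = t))"
    using balance[of "(nlocs N + 1, _)"] out_arcs_end by (intro sum.cong) auto
  moreover have "(\<Sum>a \<in> in_arcs G n. path_flow p a) = (\<Sum>a \<in> out_arcs G n. path_flow p a)"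
    if "n \<in> locations N \<times> periods T" for n
    using balance[of n] that by (auto simp: in_locations_iff)
  ultimately show ?thesis
    using st by (simp add: vehicle_flow_def path_flow_def of_bool_def)
qed

text \<open>Backward tracing: a used idle arc has positive inflow at its tail, which lies at the
  same location one period earlier. Time cannot decrease forever, so a travel arc into the location
  is met.\<close>

lemma flow_entry:
  assumes nonneg: "\<And>a. a \<in> arcs G \<Longrightarrow> 0 \<le> (w a :: real)"
    and cons: "\<And>n. n \<in> locations N \<times> periods T \<Longrightarrow> sum w (in_arcs G n) = sum w (out_arcs G n)"
    and "a \<in> arcs G" "0 < w a" "fst (snd a) \<in> locations N"
  shows "\<exists>b \<in> entry_arcs N (fst (snd a)). 0 < w b"
  using assms(3-5)
proof (induction "snd (snd a)" arbitrary: a rule: less_induct)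
  case less
  show ?case
  proof (cases "a \<in> travel N")
    case True
    then show ?thesis using less.prems by (intro bexI[of _ a]) (auto simp: entry_arcs_def)
  next
    case False
    then have tail: "fst (fst a) = fst (snd a)"
      using nontravel_arc[OF less.prems(1)] by (simp add: idle_def prod_eq_iff)
    have "0 < sum w (out_arcs G (fst a))"
      using less.prems nonneg by (intro sum_pos2[of _ a]) auto
    also have "\<dots> = sum w (in_arcs G (fst a))"
      using cons[of "fst a"] tail less.prems arcD[of a] by (simp add: mem_Times_iff)
    finally obtain b where b: "b \<in> in_arcs G (fst a)" "0 < w b"
      using sum_pos_obtain by blast
    then have "snd b = fst a" "b \<in> arcs G" by auto
    then show ?thesis
      using less.hyps[of b] less.prems arcD(1)[of a] tail b(2) by simp
  qed
qed

text \<open>The same backward tracing, now across locations, until the start depot stops it. It is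
  stated for any nonnegative conserved \<open>w\<close> because it will be applied to a residual,
  which is not a unit flow.\<close>

lemma flow_start:
  assumes nonneg: "\<And>a. a \<in> arcs G \<Longrightarrow> 0 \<le> (w a :: real)"
    and cons: "\<And>n. n \<in> locations N \<times> periods T \<Longrightarrow> sum w (in_arcs G n) = sum w (out_arcs G n)"
    and "a \<in> arcs G" "0 < w a"
  shows "\<exists>t \<in> periods T. \<exists>b \<in> out_arcs G (0, t). 0 < w b"
  using assms(3-4)
proof (induction "snd (fst a)" arbitrary: a rule: less_induct)
  case less
  show ?case
  proof (cases "fst (fst a) = 0")
    case True
    then have "a \<in> out_arcs G (0, snd (fst a))" using less.prems by (simp add: prod_eq_iff)
    then show ?thesis using less.prems arcD by blast
  next
    case False
    have "0 < sum w (out_arcs G (fst a))"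
      using less.prems nonneg by (intro sum_pos2[of _ a]) auto
    also have "\<dots> = sum w (in_arcs G (fst a))"
      using cons[of "fst a"] False less.prems arcD[of a]
      by (auto simp: mem_Times_iff in_locations_iff)
    finally obtain b where b: "b \<in> in_arcs G (fst a)" "0 < w b"
      using sum_pos_obtain by blast
    then show ?thesis
      using less.hyps[of b] less.prems arcD(1)[of b] by auto
  qed
qed

text \<open>Forward tracing: at a proper location positive inflow forces positive outflow, and the
  horizon bounds the number of steps.\<close>

lemma flow_walk:
  assumes nonneg: "\<And>a. a \<in> arcs G \<Longrightarrow> 0 \<le> (w a :: real)"
    and cons: "\<And>n. n \<in> locations N \<times> periods T \<Longrightarrow> sum w (in_arcs G n) = sum w (out_arcs G n)"
    and "a \<in> arcs G" "0 < w a"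
  shows "\<exists>p. \<exists>t \<in> periods T. cas (fst a) p (nlocs N + 1, t) \<and> set p \<subseteq> {b \<in> arcs G. 0 < w b}"
  using assms(3-4)
proof (induction "T + 1 - snd (snd a)" arbitrary: a rule: less_induct)
  case less
  show ?case
  proof (cases "fst (snd a) = nlocs N + 1")
    case True
    then have "cas (fst a) [a] (nlocs N + 1, snd (snd a))" by (simp add: prod_eq_iff)
    then show ?thesis
      using less.prems arcD(7)[of a] by (intro exI[of _ "[a]"] bexI[of _ "snd (snd a)"]) auto
  next
    case False
    have "0 < sum w (in_arcs G (snd a))"
      using less.prems nonneg by (intro sum_pos2[of _ a]) auto
    also have "\<dots> = sum w (out_arcs G (snd a))"
      using cons[of "snd a"] False less.prems arcD[of a]
      by (auto simp: mem_Times_iff in_locations_iff)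
    finally obtain b where b: "b \<in> out_arcs G (snd a)" "0 < w b"
      using sum_pos_obtain by blast
    then have "T + 1 - snd (snd b) < T + 1 - snd (snd a)"
      using arcD[of b] by (auto simp: periods_def)
    from less.hyps[OF this] b obtain p t where "t \<in> periods T"
      "cas (snd a) p (nlocs N + 1, t)" "set p \<subseteq> {b \<in> arcs G. 0 < w b}"
      by auto
    then show ?thesis
      using less.prems by (intro exI[of _ "a # p"] bexI[of _ t]) auto
  qed
qed

text \<open>
  Subtracting the flow of a path of arcs in use from a binary flow leaves a nonnegative flow that
  does not leave the start depot; as the network is acyclic, nothing remains.
\<close>

lemma binary_flow_is_path:
  assumes "vehicle_flow {0, 1} T N w"
  shows "\<exists>p. depot_path T N p \<and> (\<forall>a \<in> arcs G. w a = path_flow p a)"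
proof -
  note w = vehicle_flowD[OF assms]
  have nonneg: "0 \<le> w a" if "a \<in> arcs G" for a
    using w(1)[OF that] by auto
  have "0 < (\<Sum>t \<in> periods T. \<Sum>a \<in> out_arcs G (0, t). w a)" using w(2) by simp
  then obtain s where s: "s \<in> periods T" "0 < (\<Sum>a \<in> out_arcs G (0, s). w a)"
    by (rule sum_pos_obtain)
  from s(2) obtain a where a: "a \<in> out_arcs G (0, s)" "0 < w a"
    by (rule sum_pos_obtain)
  then obtain p t where p: "t \<in> periods T" "cas (0, s) p (nlocs N + 1, t)"
    "set p \<subseteq> {b \<in> arcs G. 0 < w b}"
    using flow_walk[of w a] nonneg w(4) by auto
  then have path: "depot_path T N p" using s(1) by (auto simp: depot_path_iff)
  note flow = vehicle_flowD[OF depot_path_flow[OF path]]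
  define r where "r a = w a - path_flow p a" for a
  \<comment> \<open>Arcs of \<open>p\<close> carry positive flow, which binarity makes equal to 1,
    so subtracting the indicator cannot go below zero.\<close>
  have r_nonneg: "0 \<le> r a" if "a \<in> arcs G" for a
    using p(3) w(1)[OF that] by (auto simp: r_def path_flow_def)
  have r_cons: "sum r (in_arcs G n) = sum r (out_arcs G n)" if "n \<in> locations N \<times> periods T" for n
    using w(4)[OF that] flow(4)[OF that] by (simp add: r_def sum_subtractf)
  have r_out: "(\<Sum>t \<in> periods T. \<Sum>a \<in> out_arcs G (0, t). r a) = 0"
    using w(2) flow(2) by (simp add: r_def sum_subtractf)
  have not_pos: "\<not> 0 < r a" if a: "a \<in> arcs G" for a
  proof
    assume "0 < r a"
    then obtain t b where tb: "t \<in> periods T" "b \<in> out_arcs G (0, t)" "0 < r b"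
      using flow_start[of r a] r_nonneg r_cons a by blast
    then have "0 < sum r (out_arcs G (0, t))"
      using r_nonneg by (intro sum_pos2[of _ b]) auto
    then have "0 < (\<Sum>t \<in> periods T. \<Sum>a \<in> out_arcs G (0, t). r a)"
      using tb(1) r_nonneg by (intro sum_pos2[of _ t] sum_nonneg) auto
    then show False using r_out by simp
  qed
  have "w a = path_flow p a" if "a \<in> arcs G" for a
    using not_pos[OF that] r_nonneg[OF that] by (simp add: r_def)
  with path show ?thesis by blast
qed

section \<open>Costs and visits of depot paths\<close>

lemma path_cost_conv:
  assumes "depot_path T N p"
  shows "(\<Sum>a \<in> arcs G. acost N a * path_flow p a) = path_cost N p"
proof -
  have "(\<Sum>a \<in> arcs G. acost N a * path_flow p a) = (\<Sum>a \<in> set p. acost N a)"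
    using depot_pathD[OF assms]
    by (intro sum.mono_neutral_cong_right) (auto simp: path_flow_def)
  then show ?thesis
    using depot_pathD(1)[OF assms] by (simp add: path_cost_def sum_list_distinct_conv_sum_set)
qed

lemma path_cost_nonneg: "depot_path T N p \<Longrightarrow> 0 \<le> path_cost N p"
  using depot_pathD(2)[of p] by (auto simp: path_cost_def intro!: sum_list_nonneg cost_nonneg)

lemma depot_path_direct: "depot_path T N [direct_arc T N]"
  using direct_arc_travel travel_subset_arcs
  by (auto simp: depot_path_iff direct_arc_def periods_def)

text \<open>\<open>visits\<close> also accepts heads of idle arcs. Tracing back shows that the
  location was then entered by a travel arc, which is what the visit constraint of (EX) and the
  at-most-once condition on mission paths count.\<close>

lemma depot_path_visits:
  assumes "depot_path T N p" "i \<in> locations N"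
  shows "visits p i \<longleftrightarrow> set p \<inter> entry_arcs N i \<noteq> {}"
proof
  assume "visits p i"
  then obtain a where a: "a \<in> set p" "fst (snd a) = i" by (auto simp: visits_def)
  have "\<exists>b \<in> entry_arcs N (fst (snd a)). 0 < path_flow p b"
    using vehicle_flowD(4)[OF depot_path_flow[OF assms(1)]] depot_pathD[OF assms(1)] a assms(2)
    by (intro flow_entry) (auto simp: path_flow_def)
  then show "set p \<inter> entry_arcs N i \<noteq> {}" using a by (auto simp: path_flow_def)
qed (auto simp: visits_def entry_arcs_def)

lemma depot_path_idle:
  assumes "depot_path T N p" "idle i t \<in> set p"
  shows "i \<in> locations N" "t \<in> periods T" "t + 1 \<in> periods T" "visits p i"
  using depot_pathD(2)[OF assms(1)] assms(2) idle_in_arcs_iff[of i t]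
  by (force simp: visits_def idle_def)+

lemma sum_path_flow_entry:
  "(\<Sum>a \<in> entry_arcs N i. path_flow p a) = real (card (set p \<inter> entry_arcs N i))"
  by (simp add: path_flow_def of_bool_def sum.If_cases Int_commute)

end

section \<open>Distributing path weights over a fleet\<close>

text \<open>\<open>D\<close> is the domain of the path variables, \<open>E\<close> that of the flow variables.\<close>

definition domain_pair :: "real set \<Rightarrow> real set \<Rightarrow> bool" where
  "domain_pair D E \<longleftrightarrow> D = {0, 1} \<and> E = {0, 1} \<or> D = {0..} \<and> E = {0..1}"

lemma domain_pairD:
  assumes "domain_pair D E"
  shows "0 \<in> D" "x \<in> D \<Longrightarrow> 0 \<le> x"
  using assms by (auto simp: domain_pair_def)

text \<open>In the binary case a subset sum is a cardinality of at most 1; in the fractional case it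
  only has to lie between 0 and 1. The bound on the total supplies the upper limit that
  \<open>D\<close> lacks in the relaxation.\<close>

lemma subset_sum_in_domain:
  assumes "domain_pair D E" "finite A" "\<And>a. a \<in> A \<Longrightarrow> f a \<in> D" "sum f A \<le> 1" "B \<subseteq> A"
  shows "sum f B \<in> E"
proof -
  have nonneg: "0 \<le> f a" if "a \<in> A" for a
    using assms(1,3) that domain_pairD(2) by blast
  have "0 \<le> sum f B" using assms(5) nonneg by (intro sum_nonneg) auto
  moreover have "sum f B \<le> 1"
    using sum_mono2[of A B f] assms nonneg by force
  moreover have "sum f B = real (card {a \<in> B. f a = 1})" if "D = {0, 1}"
  proof -
    have "sum f B = (\<Sum>a \<in> B. if f a = 1 then 1 else 0)"
      using assms(3,5) that by (intro sum.cong) auto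
    then show ?thesis
      using finite_subset[OF assms(5,2)] by (simp add: sum.If_cases Int_def)
  qed
  ultimately show ?thesis
    using assms(1) by (auto simp: domain_pair_def)
qed

text \<open>\<open>q0\<close> is the slack path: its own weight is not reproduced, so all other
  weights can be met while each vehicle gets total 1. Paths of binary weight 1 are matched
  injectively with vehicles, and vehicles left over take \<open>q0\<close>. Fractional weights are
  spread evenly, a share of one \<open>U\<close>-th per vehicle, and \<open>q0\<close> fills up the
  rest.\<close>

lemma split_weights:
  fixes w :: "'q \<Rightarrow> real"
  assumes dom: "domain_pair D E" and fin: "finite Q" and q0: "q0 \<in> Q"
    and w: "\<And>q. q \<in> Q \<Longrightarrow> w q \<in> D" and sum: "sum w Q \<le> real U" and U: "1 \<le> U"
  shows "\<exists>l. (\<forall>u \<in> {1..U}. (\<forall>q \<in> Q. l u q \<in> D) \<and> sum (l u) Q = 1) \<and>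
    (\<forall>q \<in> Q - {q0}. (\<Sum>u \<in> {1..U}. l u q) = w q)"
proof -
  have nonneg: "0 \<le> w q" if "q \<in> Q" for q
    using dom w that domain_pairD(2) by blast
  have sum': "sum w (Q - {q0}) \<le> real U"
    using sum nonneg[OF q0] fin q0 by (simp add: sum_diff1)
  consider "D = {0, 1}" | "D = {0..}" using dom by (auto simp: domain_pair_def)
  then show ?thesis
  proof cases
    case 1
    define A where "A = {q \<in> Q - {q0}. w q = 1}"
    have finA: "finite A" using fin by (simp add: A_def)
    have "real (card A) = sum w A" by (simp add: A_def)
    also have "\<dots> \<le> sum w (Q - {q0})"
      using fin nonneg by (intro sum_mono2) (auto simp: A_def)
    finally have "card A \<le> card {1..U}" using sum' by simp
    then obtain f where f: "f ` A \<subseteq> {1..U}" "inj_on f A"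
      using card_le_inj[OF finA, of "{1..U}"] by auto
    define l :: "nat \<Rightarrow> 'q \<Rightarrow> real" where
      "l u q = of_bool (if q = q0 then u \<notin> f ` A else q \<in> A \<and> f q = u)" for u q
    have "sum (l u) Q = 1" for u
    proof (cases "u \<in> f ` A")
      case True
      then obtain a where a: "a \<in> A" "u = f a" by auto
      have "sum (l u) Q = (\<Sum>q \<in> Q. if q = a then 1 else 0)"
        using a f(2) by (intro sum.cong) (auto simp: l_def A_def inj_on_def)
      then show ?thesis using a fin by (simp add: A_def)
    next
      case False
      have "sum (l u) Q = (\<Sum>q \<in> Q. if q = q0 then 1 else 0)"
        using False by (intro sum.cong) (auto simp: l_def)
      then show ?thesis using q0 fin by simp
    qed
    moreover have "(\<Sum>u \<in> {1..U}. l u q) = w q" if "q \<in> Q - {q0}" for q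
    proof (cases "q \<in> A")
      case True
      have "(\<Sum>u \<in> {1..U}. l u q) = (\<Sum>u \<in> {1..U}. if u = f q then 1 else 0)"
        using that True by (intro sum.cong) (auto simp: l_def)
      also have "\<dots> = 1" using f(1) True by (simp add: image_subset_iff)
      finally show ?thesis using True by (simp add: A_def)
    next
      case False
      then have "w q = 0" using that w[of q] 1 by (auto simp: A_def)
      then show ?thesis using that False by (simp add: l_def)
    qed
    ultimately show ?thesis using 1 by (intro exI[of _ l]) (auto simp: l_def)
  next
    case 2
    define l where
      "l u q = (if q = q0 then 1 - sum w (Q - {q0}) / real U else w q / real U)" for u :: nat and q
    have "sum (l u) Q = 1" for u
    proof -
      have "sum (l u) Q = l u q0 + (\<Sum>q \<in> Q - {q0}. w q / real U)"
        by (subst sum.remove[OF fin q0]) (auto simp: l_def intro!: sum.cong)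
      then show ?thesis by (simp add: l_def sum_divide_distrib)
    qed
    moreover have "0 \<le> l u q" if "q \<in> Q" for u q
      using nonneg[OF that] sum' U by (auto simp: l_def)
    moreover have "(\<Sum>u \<in> {1..U}. l u q) = w q" if "q \<in> Q - {q0}" for q
      using that U by (simp add: l_def)
    ultimately show ?thesis using 2 by (intro exI[of _ l]) auto
  qed
qed

context ts_network
begin

text \<open>Conservation and the unit conditions are linear, so they pass from the paths to a
  combination of total weight 1. Only the domain needs care: the value on an arc is the weight of
  the paths through it, a subset sum.\<close>

lemma mixture_flow:
  assumes dom: "domain_pair D E" and fin: "finite Q"
    and path: "\<And>q. q \<in> Q \<Longrightarrow> depot_path T N (f q)"
    and l: "\<And>q. q \<in> Q \<Longrightarrow> l q \<in> D" "sum l Q = 1"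
  shows "vehicle_flow E T N (\<lambda>a. \<Sum>q \<in> Q. l q * path_flow (f q) a)"
proof -
  note flow = vehicle_flowD[OF depot_path_flow[OF path]]
  have swap: "(\<Sum>a \<in> A. \<Sum>q \<in> Q. l q * path_flow (f q) a) = (\<Sum>q \<in> Q. l q * (\<Sum>a \<in> A. path_flow (f q) a))"
    for A by (subst sum.swap) (simp add: sum_distrib_left)
  have swap2: "(\<Sum>t \<in> S. \<Sum>a \<in> A t. \<Sum>q \<in> Q. l q * path_flow (f q) a) =
      (\<Sum>q \<in> Q. l q * (\<Sum>t \<in> S. \<Sum>a \<in> A t. path_flow (f q) a))" for A and S :: "nat set"
    unfolding swap by (subst sum.swap) (simp add: sum_distrib_left)
  have "(\<Sum>q \<in> Q. l q * path_flow (f q) a) \<in> E" for a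
  proof -
    have "(\<Sum>q \<in> Q. l q * path_flow (f q) a) = (\<Sum>q \<in> {q \<in> Q. a \<in> set (f q)}. l q)"
      using fin by (intro sum.mono_neutral_cong_right) (auto simp: path_flow_def)
    then show ?thesis
      using subset_sum_in_domain[OF dom fin l(1), where B = "{q \<in> Q. a \<in> set (f q)}"] l(2) by auto
  qed
  moreover have "(\<Sum>t \<in> periods T. \<Sum>a \<in> out_arcs G (0, t). \<Sum>q \<in> Q. l q * path_flow (f q) a) = 1"
    "(\<Sum>t \<in> periods T. \<Sum>a \<in> in_arcs G (nlocs N + 1, t). \<Sum>q \<in> Q. l q * path_flow (f q) a) = 1"
    unfolding swap2 using l(2) flow(2,3) by simp_all
  moreover have "(\<Sum>a \<in> in_arcs G n. \<Sum>q \<in> Q. l q * path_flow (f q) a) =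
      (\<Sum>a \<in> out_arcs G n. \<Sum>q \<in> Q. l q * path_flow (f q) a)" if "n \<in> locations N \<times> periods T" for n
    unfolding swap using flow(4)[OF _ that] by (intro sum.cong) simp_all
  ultimately show ?thesis unfolding vehicle_flow_def by blast
qed

text \<open>Vehicles that are not needed to carry the weights of the paths take the direct arc.\<close>

lemma weights_to_fleet:
  assumes dom: "domain_pair D E" and fin: "finite Q"
    and path: "\<forall>q \<in> Q. depot_path T N (f q)"
    and q0: "q0 \<in> Q" "f q0 = [direct_arc T N]"
    and w: "\<forall>q \<in> Q. w q \<in> D" "sum w Q \<le> real U" and U: "1 \<le> U"
  shows "\<exists>z. (\<forall>u \<in> {1..U}. vehicle_flow E T N (z u)) \<and>
    (\<forall>A c. finite A \<longrightarrow> (direct_arc T N \<in> A \<longrightarrow> c (direct_arc T N) = 0) \<longrightarrow>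
      (\<Sum>u \<in> {1..U}. \<Sum>a \<in> A. c a * z u a) = (\<Sum>q \<in> Q. w q * (\<Sum>a \<in> A. c a * path_flow (f q) a)))"
proof -
  obtain l where l: "\<And>u. u \<in> {1..U} \<Longrightarrow> (\<forall>q \<in> Q. l u q \<in> D) \<and> sum (l u) Q = 1"
    "\<And>q. q \<in> Q - {q0} \<Longrightarrow> (\<Sum>u \<in> {1..U}. l u q) = w q"
    using split_weights[OF dom fin q0(1) _ w(2) U] w(1) by blast
  define z where "z u a = (\<Sum>q \<in> Q. l u q * path_flow (f q) a)" for u a
  have "vehicle_flow E T N (z u)" if "u \<in> {1..U}" for u
    unfolding z_def using l(1)[OF that] path by (intro mixture_flow[OF dom fin]) auto
  moreover have "(\<Sum>u \<in> {1..U}. \<Sum>a \<in> A. c a * z u a) =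
      (\<Sum>q \<in> Q. w q * (\<Sum>a \<in> A. c a * path_flow (f q) a))"
    if A: "finite A" "direct_arc T N \<in> A \<longrightarrow> c (direct_arc T N) = 0" for A and c :: "tsarc \<Rightarrow> real"
  proof -
    \<comment> \<open>The uncontrolled weight of \<open>q0\<close> drops out, since its only arc is
      the direct one, which \<open>A\<close> avoids or \<open>c\<close> annihilates. Cost, job
      entries and idle arcs are all read off with such \<open>A\<close> and
      \<open>c\<close>.\<close>
    have g0: "(\<Sum>a \<in> A. c a * path_flow (f q0) a) = 0"
      using A(2) by (intro sum.neutral) (auto simp: q0(2) path_flow_def)
    have "(\<Sum>u \<in> {1..U}. \<Sum>a \<in> A. c a * z u a) =
        (\<Sum>u \<in> {1..U}. \<Sum>q \<in> Q. l u q * (\<Sum>a \<in> A. c a * path_flow (f q) a))"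
      unfolding z_def sum_distrib_left by (subst sum.swap) (simp add: ac_simps)
    also have "\<dots> = (\<Sum>q \<in> Q. (\<Sum>u \<in> {1..U}. l u q) * (\<Sum>a \<in> A. c a * path_flow (f q) a))"
      by (subst sum.swap) (simp add: sum_distrib_right)
    also have "\<dots> = (\<Sum>q \<in> Q. w q * (\<Sum>a \<in> A. c a * path_flow (f q) a))"
      using l(2) g0 by (intro sum.cong) auto
    finally show ?thesis .
  qed
  ultimately show ?thesis by blast
qed

end

section \<open>From (SP) to (EX)\<close>

locale instance_jevrp =
  fixes P :: jevrp
  assumes valid_P: "valid_instance P"

sublocale instance_jevrp \<subseteq> M: ts_network "horizon P" "mission P"
  by unfold_locales (use valid_P in \<open>simp add: valid_instance_def\<close>)

sublocale instance_jevrp \<subseteq> E: ts_network "horizon P" "emitting P"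
  by unfold_locales (use valid_P in \<open>simp add: valid_instance_def\<close>)

context instance_jevrp
begin

lemma finite_mpaths [simp]: "finite (mission_paths P)"
  and finite_epaths [simp]: "finite (emitting_paths P)"
  using valid_P by (auto intro: finite_mission_paths finite_emitting_paths)

lemma finite_mpaths_of [simp]: "finite (mission_paths_of P i)"
  by (simp add: mission_paths_of_def)

lemma jobD:
  assumes "i \<in> jobs P"
  shows "covers P i \<subseteq> locations (emitting P)" "finite (covers P i)" "0 < workload P i"
    "wstart P i \<le> wend P i" "wend P i \<le> horizon P + 1"
proof -
  show "covers P i \<subseteq> locations (emitting P)"
    using valid_P assms by (simp add: valid_instance_def)
  then show "finite (covers P i)" by (rule finite_subset) simp
qed (use valid_P assms in \<open>simp_all add: valid_instance_def\<close>)

lemma mission_pathsD: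
  assumes "q \<in> mission_paths P"
  shows "depot_path (horizon P) (mission P) (fst q)"
    "i \<in> jobs P \<Longrightarrow> card (set (fst q) \<inter> entry_arcs (mission P) i) \<le> 1"
    "(i, t) \<in> snd q \<Longrightarrow> i \<in> jobs P \<and> visits (fst q) i"
  using assms by (auto simp: mission_paths_def entry_arcs_def Int_def)

lemma mission_path_work:
  assumes "q \<in> mission_paths_of P i" "i \<in> jobs P"
  shows "\<exists>s e. snd q `` {i} = {s..<e}" "workload P i \<le> card (snd q `` {i})"
    "snd q `` {i} \<subseteq> {wstart P i..<wend P i}" "(i, t) \<in> snd q \<Longrightarrow> idle i t \<in> set (fst q)"
proof -
  obtain p W where q: "q = (p, W)" by (cases q)
  have "(\<exists>s e. W `` {i} = {s..<e}) \<and> workload P i \<le> card (W `` {i}) \<and>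
      W `` {i} \<subseteq> {wstart P i..<wend P i} \<and> (\<forall>t \<in> W `` {i}. idle i t \<in> set p)"
    using assms by (simp add: q mission_paths_def mission_paths_of_def)
  then show "\<exists>s e. snd q `` {i} = {s..<e}" "workload P i \<le> card (snd q `` {i})"
    "snd q `` {i} \<subseteq> {wstart P i..<wend P i}" "(i, t) \<in> snd q \<Longrightarrow> idle i t \<in> set (fst q)"
    unfolding q by auto
qed

lemma card_entry_arcs:
  assumes "q \<in> mission_paths P" "i \<in> jobs P"
  shows "real (card (set (fst q) \<inter> entry_arcs (mission P) i)) = of_bool (q \<in> mission_paths_of P i)"
proof -
  have "card (set (fst q) \<inter> entry_arcs (mission P) i) \<noteq> 0 \<longleftrightarrow> visits (fst q) i"
    using M.depot_path_visits[OF mission_pathsD(1)[OF assms(1)] assms(2)] by (simp add: card_eq_0_iff)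
  then have "card (set (fst q) \<inter> entry_arcs (mission P) i) = (if visits (fst q) i then 1 else 0)"
    using mission_pathsD(2)[OF assms] by presburger
  then show ?thesis using assms(1) by (simp add: mission_paths_of_def)
qed

lemma sum_delta_paths_of:
  "(\<Sum>q \<in> mission_paths P. delta q i t * w q) = (\<Sum>q \<in> mission_paths_of P i. delta q i t * w q)"
  using mission_pathsD(3)
  by (intro sum.mono_neutral_right) (auto simp: mission_paths_of_def delta_def)

definition started :: "mpath \<Rightarrow> nat \<Rightarrow> nat \<Rightarrow> real" where
  "started q i t = of_bool (\<exists>r \<le> t. (i, r) \<in> snd q)"

text \<open>The quantifier starts at \<open>t\<close> itself: the last working period must still
  count as not ended, so that the difference to \<open>started\<close> is the work
  indicator.\<close>

definition ended :: "mpath \<Rightarrow> nat \<Rightarrow> nat \<Rightarrow> real" where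
  "ended q i t = of_bool (\<forall>r \<ge> t. (i, r) \<notin> snd q)"

text \<open>With work in \<open>{s..<e}\<close>, one step function jumps at \<open>s\<close> and the
  other at \<open>e\<close>. Positive workload makes the interval nonempty; for empty work the
  difference would be -1 instead of 0.\<close>

lemma started_diff_ended:
  assumes "q \<in> mission_paths_of P i" "i \<in> jobs P"
  shows "started q i t - ended q i t = delta q i t"
proof -
  obtain s e where se: "snd q `` {i} = {s..<e}" using mission_path_work(1)[OF assms] by blast
  then have mem: "(i, r) \<in> snd q \<longleftrightarrow> s \<le> r \<and> r < e" for r
    by (simp only: Image_singleton_iff[symmetric] atLeastLessThan_iff)
  have "s < e" using mission_path_work(2)[OF assms] jobD(3)[OF assms(2)] se by auto
  have "(\<exists>r \<le> t. (i, r) \<in> snd q) \<longleftrightarrow> s \<le> t"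
    unfolding mem using \<open>s < e\<close> by (auto intro: exI[of _ s])
  moreover have "(\<forall>r \<ge> t. (i, r) \<notin> snd q) \<longleftrightarrow> e \<le> t"
    unfolding mem using \<open>s < e\<close> by (auto dest: spec[of _ "max s t"])
  ultimately show ?thesis
    using \<open>s < e\<close> by (auto simp: started_def ended_def delta_def mem)
qed

lemma sum_delta_periods:
  assumes "q \<in> mission_paths_of P i" "i \<in> jobs P"
  shows "real (workload P i) \<le> (\<Sum>t \<in> tperiods P. delta q i t)"
proof -
  have "snd q `` {i} \<subseteq> tperiods P"
    using mission_path_work(3)[OF assms] jobD(5)[OF assms(2)] by (force simp: periods_def)
  then have "{t \<in> tperiods P. (i, t) \<in> snd q} = snd q `` {i}" by auto
  then show ?thesis
    using mission_path_work(2)[OF assms] by (simp add: delta_def sum.If_cases Int_def)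
qed

text \<open>Writing the omitted term as an empty sum lets the linear identity of
  \<open>weights_to_fleet\<close> treat the last period like the others.\<close>

lemma idle_val_conv: "idle_val P w l t = (\<Sum>a \<in> (if t + 1 \<in> tperiods P then {idle l t} else {}). w a)"
  by (simp add: idle_val_def)

text \<open>The constraints of (EX) are averaged from single paths, the paths of a job having total
  weight 1, or inherited from the covering constraint of (SP). Costs agree exactly because the
  direct arc is free.\<close>

lemma sp_to_ex:
  assumes dom: "domain_pair D E" and s: "s \<in> sp_feasible D P"
  shows "\<exists>s' \<in> ex_feasible E P. ex_cost P s' = sp_cost P s"
proof -
  let ?Q = "mission_paths P" and ?R = "emitting_paths P"
  let ?Qi = "mission_paths_of P"
  have sQ: "\<And>q. q \<in> ?Q \<Longrightarrow> zbar s q \<in> D" and sR: "\<And>p. p \<in> ?R \<Longrightarrow> xbar s p \<in> D"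
    and one: "\<And>i. i \<in> jobs P \<Longrightarrow> (\<Sum>q \<in> ?Qi i. zbar s q) = 1"
    and le: "(\<Sum>q \<in> ?Q. zbar s q) \<le> real (nmission P)" "(\<Sum>p \<in> ?R. xbar s p) \<le> real (nemitting P)"
    and cov: "\<And>i t. i \<in> jobs P \<Longrightarrow> t \<in> tperiods P \<Longrightarrow>
      (\<Sum>q \<in> ?Q. delta q i t * zbar s q) \<le> (\<Sum>p \<in> ?R. gcov P p i t * xbar s p)"
    using s by (auto simp: sp_feasible_def)
  have nn: "0 \<le> zbar s q" if "q \<in> ?Q" for q using sQ[OF that] domain_pairD(2)[OF dom] by blast
  have nn': "0 \<le> xbar s p" if "p \<in> ?R" for p using sR[OF that] domain_pairD(2)[OF dom] by blast
  have QiQ: "?Qi i \<subseteq> ?Q" for i by (auto simp: mission_paths_of_def)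
  have nni: "0 \<le> zbar s q" if "q \<in> ?Qi i" for q i using nn that QiQ by blast

  let ?dM = "direct_arc (horizon P) (mission P)" and ?dE = "direct_arc (horizon P) (emitting P)"
  \<comment> \<open>The direct route with empty work is a mission path: it visits no job, so the
    workload conditions are vacuous.\<close>
  have "\<not> visits [?dM] i" if "i \<in> jobs P" for i
    using that by (auto simp: visits_def direct_arc_def in_locations_iff)
  moreover have "card {a \<in> set [?dM]. a \<in> travel (mission P) \<and> fst (snd a) = i} \<le> card {?dM}" for i
    by (intro card_mono) auto
  ultimately have q0: "([?dM], {}) \<in> ?Q"
    using M.depot_path_direct by (simp add: mission_paths_def)
  have r0: "[?dE] \<in> ?R" using E.depot_path_direct by (simp add: emitting_paths_def)
  have nU: "1 \<le> nmission P" "1 \<le> nemitting P" using valid_P by (auto simp: valid_instance_def)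

  have paths: "\<forall>q \<in> ?Q. depot_path (horizon P) (mission P) (fst q)"
    "\<forall>p \<in> ?R. depot_path (horizon P) (emitting P) (id p)"
    using mission_pathsD(1) by (auto simp: emitting_paths_def)
  obtain z where z: "\<forall>u \<in> {1..nmission P}. vehicle_flow E (horizon P) (mission P) (z u)"
    and zsum: "\<forall>A c. finite A \<longrightarrow> (?dM \<in> A \<longrightarrow> c ?dM = 0) \<longrightarrow>
      (\<Sum>u \<in> {1..nmission P}. \<Sum>a \<in> A. c a * z u a) =
      (\<Sum>q \<in> ?Q. zbar s q * (\<Sum>a \<in> A. c a * path_flow (fst q) a))"
    using M.weights_to_fleet[where f = fst and w = "zbar s", OF dom finite_mpaths paths(1) q0
      fst_conv _ le(1) nU(1)] sQ by blast
  obtain x where x: "\<forall>v \<in> {1..nemitting P}. vehicle_flow E (horizon P) (emitting P) (x v)"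
    and xsum: "\<forall>A c. finite A \<longrightarrow> (?dE \<in> A \<longrightarrow> c ?dE = 0) \<longrightarrow>
      (\<Sum>v \<in> {1..nemitting P}. \<Sum>a \<in> A. c a * x v a) =
      (\<Sum>p \<in> ?R. xbar s p * (\<Sum>a \<in> A. c a * path_flow (id p) a))"
    using E.weights_to_fleet[where f = id and w = "xbar s", OF dom finite_epaths paths(2) r0
      id_apply _ le(2) nU(2)] sR by blast
  note zsum = zsum[rule_format] and xsum = xsum[rule_format, unfolded id_apply]
  \<comment> \<open>Only paths that visit \<open>i\<close> enter the job variables: their weights
    sum to 1, which keeps the values in \<open>E\<close> and makes \<open>yEvar\<close> equal to 1
    after the window. Any other path would count as ended in every period.\<close>
  define s' where "s' = \<lparr>zvar = z, xvar = x,
    ySvar = \<lambda>i t. \<Sum>q \<in> ?Qi i. started q i t * zbar s q,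
    yEvar = \<lambda>i t. \<Sum>q \<in> ?Qi i. ended q i t * zbar s q\<rparr>"

  have entry: "(\<Sum>u \<in> {1..nmission P}. \<Sum>t \<in> tperiods P.
      \<Sum>a \<in> in_arcs (mnet P) (i, t) \<inter> travel (mission P). z u a) = 1" if i: "i \<in> jobs P" for i
  proof -
    have "?dM \<notin> entry_arcs (mission P) i"
      using i by (auto simp: entry_arcs_def direct_arc_def in_locations_iff)
    then have "(\<Sum>u \<in> {1..nmission P}. \<Sum>a \<in> entry_arcs (mission P) i. z u a) =
        (\<Sum>q \<in> ?Q. zbar s q * (\<Sum>a \<in> entry_arcs (mission P) i. path_flow (fst q) a))"
      using zsum[of "entry_arcs (mission P) i" "\<lambda>_. 1"] by simp
    also have "\<dots> = (\<Sum>q \<in> ?Q. zbar s q * of_bool (q \<in> ?Qi i))"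
      using card_entry_arcs i by (simp add: M.sum_path_flow_entry)
    also have "\<dots> = (\<Sum>q \<in> ?Qi i. zbar s q)"
      using QiQ by (intro sum.mono_neutral_cong_right) auto
    finally show ?thesis using one[OF i] by (simp add: M.sum_entry_arcs)
  qed
  have y_dom: "(\<Sum>q \<in> ?Qi i. of_bool (b q) * zbar s q) \<in> E" if i: "i \<in> jobs P" for b i
  proof -
    have "(\<Sum>q \<in> ?Qi i. of_bool (b q) * zbar s q) = (\<Sum>q \<in> {q \<in> ?Qi i. b q}. zbar s q)"
      by (intro sum.mono_neutral_cong_right) auto
    then show ?thesis
      using subset_sum_in_domain[OF dom finite_mpaths_of, of i "zbar s" "{q \<in> ?Qi i. b q}"] sQ one[OF i] QiQ
      by auto
  qed
  have y_diff: "ySvar s' i t - yEvar s' i t = (\<Sum>q \<in> ?Qi i. delta q i t * zbar s q)"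
    if i: "i \<in> jobs P" for i t
    using started_diff_ended[OF _ i]
    by (simp add: s'_def sum_subtractf[symmetric] left_diff_distrib[symmetric])
  have y_idle: "ySvar s' i t - yEvar s' i t \<le> (\<Sum>u \<in> {1..nmission P}. idle_val P (z u) i t)"
    if i: "i \<in> jobs P" for i t
  proof -
    define A where "A = (if t + 1 \<in> tperiods P then {idle i t} else {})"
    have dA: "?dM \<notin> A"
      using i by (auto simp: A_def direct_arc_def idle_def in_locations_iff)
    have "ySvar s' i t - yEvar s' i t = (\<Sum>q \<in> ?Q. delta q i t * zbar s q)"
      using y_diff[OF i] by (simp add: sum_delta_paths_of)
    also have "\<dots> \<le> (\<Sum>q \<in> ?Q. zbar s q * (\<Sum>a \<in> A. path_flow (fst q) a))"
    proof (rule sum_mono)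
      fix q assume q: "q \<in> ?Q"
      have "delta q i t \<le> (\<Sum>a \<in> A. path_flow (fst q) a)"
      proof (cases "(i, t) \<in> snd q")
        case True
        then have idle: "idle i t \<in> set (fst q)"
          using mission_path_work(4)[of q i t] mission_pathsD(3)[OF q, of i t] q
          by (simp add: mission_paths_of_def)
        with M.depot_path_idle(3)[OF mission_pathsD(1)[OF q]] show ?thesis
          by (simp add: A_def delta_def path_flow_def)
      qed (auto simp: delta_def path_flow_def intro!: sum_nonneg)
      then show "delta q i t * zbar s q \<le> zbar s q * (\<Sum>a \<in> A. path_flow (fst q) a)"
        using nn[OF q] by (simp add: mult.commute mult_left_mono)
    qed
    also have "\<dots> = (\<Sum>u \<in> {1..nmission P}. idle_val P (z u) i t)"
      using zsum[of A "\<lambda>_. 1"] dA by (simp add: idle_val_conv A_def[symmetric] del: One_nat_def) (simp add: A_def)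
    finally show ?thesis .
  qed
  have y_cov: "ySvar s' i t - yEvar s' i t \<le>
      (\<Sum>v \<in> {1..nemitting P}. \<Sum>j \<in> covers P i. idle_val P (x v) j t)"
    if i: "i \<in> jobs P" and t: "t \<in> tperiods P" for i t
  proof -
    define A where "A = (if t + 1 \<in> tperiods P then (\<lambda>j. idle j t) ` covers P i else {})"
    have finA: "finite A" using jobD(2)[OF i] by (simp add: A_def)
    have dA: "?dE \<notin> A"
      using jobD(1)[OF i] by (auto simp: A_def direct_arc_def idle_def in_locations_iff)
    have "ySvar s' i t - yEvar s' i t \<le> (\<Sum>p \<in> ?R. gcov P p i t * xbar s p)"
      using y_diff[OF i] cov[OF i t] by (simp add: sum_delta_paths_of)
    \<comment> \<open>The indicator \<open>gcov\<close> is bounded by the number of covering idle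
      arcs on the path, as one such arc suffices.\<close>
    also have "\<dots> \<le> (\<Sum>p \<in> ?R. xbar s p * (\<Sum>a \<in> A. path_flow p a))"
    proof (rule sum_mono)
      fix p assume p: "p \<in> ?R"
      have "gcov P p i t \<le> (\<Sum>a \<in> A. path_flow p a)"
      proof (cases "\<exists>j \<in> covers P i. idle j t \<in> set p")
        case True
        then obtain j where j: "j \<in> covers P i" "idle j t \<in> set p" by blast
        then have "idle j t \<in> A"
          using E.depot_path_idle(3)[of p j t] p by (simp add: A_def emitting_paths_def)
        then have "path_flow p (idle j t) \<le> (\<Sum>a \<in> A. path_flow p a)"
          using finA by (intro member_le_sum) (auto simp: path_flow_def)
        then show ?thesis using j by (simp add: gcov_def path_flow_def)
      qed (auto simp: gcov_def path_flow_def intro!: sum_nonneg)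
      then show "gcov P p i t * xbar s p \<le> xbar s p * (\<Sum>a \<in> A. path_flow p a)"
        using nn'[OF p] by (simp add: mult.commute mult_left_mono)
    qed
    also have "\<dots> = (\<Sum>v \<in> {1..nemitting P}. \<Sum>a \<in> A. x v a)"
      using xsum[of A "\<lambda>_. 1"] finA dA by simp
    also have "\<dots> = (\<Sum>v \<in> {1..nemitting P}. \<Sum>j \<in> covers P i. idle_val P (x v) j t)"
      by (intro sum.cong) (auto simp: A_def idle_val_def sum.reindex inj_on_def idle_def)
    finally show ?thesis .
  qed
  have y_work: "real (workload P i) \<le> (\<Sum>t \<in> tperiods P. ySvar s' i t - yEvar s' i t)"
    if i: "i \<in> jobs P" for i
  proof -
    have "real (workload P i) = (\<Sum>q \<in> ?Qi i. real (workload P i) * zbar s q)"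
      using one[OF i] by (simp add: sum_distrib_left[symmetric])
    also have "\<dots> \<le> (\<Sum>q \<in> ?Qi i. (\<Sum>t \<in> tperiods P. delta q i t) * zbar s q)"
      using sum_delta_periods[OF _ i] nni by (intro sum_mono mult_right_mono) auto
    also have "\<dots> = (\<Sum>t \<in> tperiods P. ySvar s' i t - yEvar s' i t)"
      unfolding y_diff[OF i] sum_distrib_right by (rule sum.swap)
    finally show ?thesis .
  qed
  have y_mono: "ySvar s' i t \<le> ySvar s' i (t + 1)" "yEvar s' i t \<le> yEvar s' i (t + 1)" for i t
  proof -
    have "started q i t \<le> started q i (t + 1)" "ended q i t \<le> ended q i (t + 1)" for q
      by (auto simp: started_def ended_def intro: le_SucI)
    then show "ySvar s' i t \<le> ySvar s' i (t + 1)" "yEvar s' i t \<le> yEvar s' i (t + 1)"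
      using nni[of _ i] by (simp_all add: s'_def sum_mono mult_right_mono)
  qed
  have y_start: "ySvar s' i t = 0" if i: "i \<in> jobs P" and t: "t < wstart P i" for i t
  proof -
    have "started q i t = 0" if "q \<in> ?Qi i" for q
      using mission_path_work(3)[OF that i] t by (auto simp: started_def)
    then show ?thesis by (simp add: s'_def)
  qed
  have y_end: "yEvar s' i t = 1" if i: "i \<in> jobs P" and t: "wend P i \<le> t" for i t
  proof -
    have "ended q i t = 1" if "q \<in> ?Qi i" for q
      using mission_path_work(3)[OF that i] t by (auto simp: ended_def)
    then show ?thesis using one[OF i] by (simp add: s'_def)
  qed
  have fields: "zvar s' = z" "xvar s' = x" by (simp_all add: s'_def)
  have y_E: "ySvar s' i t \<in> E" "yEvar s' i t \<in> E" if "i \<in> jobs P" for i t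
    using y_dom[OF that] by (simp_all add: s'_def started_def ended_def)
  have "s' \<in> ex_feasible E P"
    unfolding ex_feasible_def mem_Collect_eq fields
    using z x entry y_E y_mono y_start y_end y_work y_idle y_cov by blast
  moreover have "ex_cost P s' = sp_cost P s"
  proof -
    have "(\<Sum>u \<in> {1..nmission P}. \<Sum>a \<in> arcs (mnet P). acost (mission P) a * z u a) =
        (\<Sum>q \<in> ?Q. path_cost (mission P) (fst q) * zbar s q)"
      using zsum[of "arcs (mnet P)" "acost (mission P)"] M.path_cost_conv[OF mission_pathsD(1)]
      by (simp add: mult.commute)
    moreover have "(\<Sum>v \<in> {1..nemitting P}. \<Sum>a \<in> arcs (enet P). acost (emitting P) a * x v a) =
        (\<Sum>p \<in> ?R. path_cost (emitting P) p * xbar s p)"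
      using xsum[of "arcs (enet P)" "acost (emitting P)"] E.path_cost_conv
      by (simp add: mult.commute emitting_paths_def)
    ultimately show ?thesis by (simp add: ex_cost_def sp_cost_def fields)
  qed
  ultimately show ?thesis by blast
qed

end

section \<open>From binary flows to paths\<close>

lemma convex_nat_interval:
  fixes A :: "nat set"
  assumes "finite A" "\<And>x y z. x \<in> A \<Longrightarrow> y \<in> A \<Longrightarrow> x \<le> z \<Longrightarrow> z \<le> y \<Longrightarrow> z \<in> A"
  shows "\<exists>s e. A = {s..<e}"
proof (cases "A = {}")
  case True
  then show ?thesis by (intro exI[of _ 0]) simp
next
  case False
  have "A \<subseteq> {Min A..<Suc (Max A)}"
    using assms(1) by (auto simp: less_Suc_eq_le)
  moreover have "z \<in> A" if "z \<in> {Min A..<Suc (Max A)}" for z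
    using that assms(2)[OF Min_in[OF assms(1) False] Max_in[OF assms(1) False], of z] by simp
  ultimately show ?thesis by blast
qed

text \<open>Several vehicles may share a path, which then counts once on the left but repeatedly on
  the right; nonnegativity of \<open>h\<close> makes this a loss in the right direction. It serves
  the fleet bounds and the costs.\<close>

lemma sum_image_indicator_le:
  fixes h :: "'b \<Rightarrow> real"
  assumes "finite Q" "finite I" "f ` I \<subseteq> Q" "\<And>x. x \<in> f ` I \<Longrightarrow> 0 \<le> h x"
  shows "(\<Sum>x \<in> Q. h x * of_bool (x \<in> f ` I)) \<le> (\<Sum>i \<in> I. h (f i))"
proof -
  have "(\<Sum>x \<in> Q. h x * of_bool (x \<in> f ` I)) = sum h (f ` I)"
    using assms(1,3) by (intro sum.mono_neutral_cong_right) auto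
  also have "\<dots> \<le> (\<Sum>i \<in> I. h (f i))"
    using sum_image_le[OF assms(2), of h f] assms(4) by (simp add: o_def)
  finally show ?thesis .
qed

lemma mono_on_periods:
  fixes y :: "nat \<Rightarrow> real"
  assumes "\<And>t. t \<in> periods T \<Longrightarrow> t + 1 \<in> periods T \<Longrightarrow> y t \<le> y (t + 1)"
    and "t \<le> t'" "t' \<in> periods T"
  shows "y t \<le> y t'"
  using assms(2,3)
proof (induction t' rule: dec_induct)
  case (step n)
  then show ?case using assms(1)[of n] by (force simp: periods_def)
qed simp

context instance_jevrp
begin

text \<open>Integrality gives each job a single visiting vehicle, so its idle arcs and its work end
  up on the same route. Vehicles with equal paths merge into one path variable, hence only an
  inequality between the costs.\<close>

lemma ex_to_sp:
  assumes s: "s \<in> EX_IP P"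
  shows "\<exists>s' \<in> SP_IP P. sp_cost P s' \<le> ex_cost P s"
proof -
  let ?U = "{1..nmission P}" and ?V = "{1..nemitting P}"
  let ?Q = "mission_paths P" and ?R = "emitting_paths P"
  let ?en = "entry_arcs (mission P)"
  have flow: "\<forall>u \<in> ?U. vehicle_flow {0, 1} (horizon P) (mission P) (zvar s u)"
    "\<forall>v \<in> ?V. vehicle_flow {0, 1} (horizon P) (emitting P) (xvar s v)"
    using s unfolding ex_feasible_def mem_Collect_eq by blast+
  have one: "\<forall>i \<in> jobs P. (\<Sum>u \<in> ?U. \<Sum>t \<in> tperiods P.
        \<Sum>a \<in> in_arcs (mnet P) (i, t) \<inter> travel (mission P). zvar s u a) = 1"
    using s unfolding ex_feasible_def mem_Collect_eq by blast
  have y: "\<forall>i \<in> jobs P. \<forall>t \<in> tperiods P. ySvar s i t \<in> {0, 1} \<and> yEvar s i t \<in> {0, 1}"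
    "\<forall>i \<in> jobs P. \<forall>t \<in> tperiods P. t + 1 \<in> tperiods P \<longrightarrow>
      ySvar s i t \<le> ySvar s i (t + 1) \<and> yEvar s i t \<le> yEvar s i (t + 1)"
    "\<forall>i \<in> jobs P. \<forall>t \<in> tperiods P. t < wstart P i \<longrightarrow> ySvar s i t = 0"
    "\<forall>i \<in> jobs P. \<forall>t \<in> tperiods P. wend P i \<le> t \<longrightarrow> yEvar s i t = 1"
    "\<forall>i \<in> jobs P. real (workload P i) \<le> (\<Sum>t \<in> tperiods P. ySvar s i t - yEvar s i t)"
    using s unfolding ex_feasible_def mem_Collect_eq by blast+
  have link: "\<forall>i \<in> jobs P. \<forall>t \<in> tperiods P.
      ySvar s i t - yEvar s i t \<le> (\<Sum>u \<in> ?U. idle_val P (zvar s u) i t)"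
    "\<forall>i \<in> jobs P. \<forall>t \<in> tperiods P.
      ySvar s i t - yEvar s i t \<le> (\<Sum>v \<in> ?V. \<Sum>j \<in> covers P i. idle_val P (xvar s v) j t)"
    using s unfolding ex_feasible_def mem_Collect_eq by blast+

  have "\<forall>u \<in> ?U. \<exists>p. depot_path (horizon P) (mission P) p \<and> (\<forall>a \<in> arcs (mnet P). zvar s u a = path_flow p a)"
    using flow(1) M.binary_flow_is_path by simp
  from bchoice[OF this] obtain p where p: "\<And>u. u \<in> ?U \<Longrightarrow> depot_path (horizon P) (mission P) (p u)"
    "\<And>u a. u \<in> ?U \<Longrightarrow> a \<in> arcs (mnet P) \<Longrightarrow> zvar s u a = path_flow (p u) a"
    by blast
  have "\<forall>v \<in> ?V. \<exists>r. depot_path (horizon P) (emitting P) r \<and> (\<forall>a \<in> arcs (enet P). xvar s v a = path_flow r a)"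
    using flow(2) E.binary_flow_is_path by simp
  from bchoice[OF this] obtain r where r: "\<And>v. v \<in> ?V \<Longrightarrow> depot_path (horizon P) (emitting P) (r v)"
    "\<And>v a. v \<in> ?V \<Longrightarrow> a \<in> arcs (enet P) \<Longrightarrow> xvar s v a = path_flow (r v) a"
    by blast

  have entry: "(\<Sum>u \<in> ?U. card (set (p u) \<inter> ?en i)) = 1" if i: "i \<in> jobs P" for i
  proof -
    have "real (\<Sum>u \<in> ?U. card (set (p u) \<inter> ?en i)) = (\<Sum>u \<in> ?U. \<Sum>a \<in> ?en i. zvar s u a)"
      unfolding of_nat_sum
    proof (rule sum.cong)
      fix u assume u: "u \<in> ?U"
      have "(\<Sum>a \<in> ?en i. zvar s u a) = (\<Sum>a \<in> ?en i. path_flow (p u) a)"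
        by (intro sum.cong refl p(2)[OF u] subsetD[OF M.entry_arcs_subset])
      then show "real (card (set (p u) \<inter> ?en i)) = (\<Sum>a \<in> ?en i. zvar s u a)"
        by (simp add: M.sum_path_flow_entry)
    qed simp
    also have "\<dots> = 1"
      using one i by (simp add: M.sum_entry_arcs)
    finally show ?thesis by linarith
  qed
  have visitor: "\<exists>u \<in> ?U. visits (p u) i \<and> (\<forall>u' \<in> ?U. visits (p u') i \<longrightarrow> u' = u) \<and>
      (\<forall>u' \<in> ?U. card (set (p u') \<inter> ?en i) \<le> 1)" if i: "i \<in> jobs P" for i
  proof -
    \<comment> \<open>Natural numbers with sum 1: one term is 1 and the others vanish.\<close>
    obtain u where u: "u \<in> ?U" "card (set (p u) \<inter> ?en i) = 1"
      "\<forall>u' \<in> ?U. u \<noteq> u' \<longrightarrow> card (set (p u') \<inter> ?en i) = 0"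
      using entry[OF i] by (subst (asm) sum_eq_1_iff) auto
    have vis: "visits (p u') i \<longleftrightarrow> card (set (p u') \<inter> ?en i) \<noteq> 0" if "u' \<in> ?U" for u'
      using M.depot_path_visits[OF p(1)[OF that] i] by (simp add: card_eq_0_iff)
    have "visits (p u) i" using vis[OF u(1)] u(2) by simp
    moreover have "u' = u" if "u' \<in> ?U" "visits (p u') i" for u'
      using vis[OF that(1)] that u(3) by metis
    moreover have "card (set (p u') \<inter> ?en i) \<le> 1" if "u' \<in> ?U" for u'
      using u(2,3) that by (cases "u = u'") simp_all
    ultimately show ?thesis using u(1) by blast
  qed

  define A where "A i = {t \<in> tperiods P. ySvar s i t = 1 \<and> yEvar s i t = 0}" for i
  have A_diff: "ySvar s i t - yEvar s i t = 1" if "t \<in> A i" for i t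
    using that by (simp add: A_def)
  have A_idle: "\<exists>u \<in> ?U. idle i t \<in> set (p u)" if i: "i \<in> jobs P" and t: "t \<in> A i" for i t
  proof -
    have tP: "t \<in> tperiods P" using t by (simp add: A_def)
    have "0 < (\<Sum>u \<in> ?U. idle_val P (zvar s u) i t)"
      using link(1) i tP A_diff[OF t] by fastforce
    then obtain u where u: "u \<in> ?U" "0 < idle_val P (zvar s u) i t" by (rule sum_pos_obtain)
    then have "t + 1 \<in> tperiods P" by (auto simp: idle_val_def split: if_splits)
    with u p(2)[OF u(1), of "idle i t"] i tP have "idle i t \<in> set (p u)"
      by (auto simp: idle_val_def M.idle_in_arcs_iff path_flow_def split: if_splits)
    then show ?thesis using u(1) by blast
  qed
  have A_cov: "\<exists>v \<in> ?V. gcov P (r v) i t = 1" if i: "i \<in> jobs P" and t: "t \<in> A i" for i t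
  proof -
    have tP: "t \<in> tperiods P" using t by (simp add: A_def)
    have "0 < (\<Sum>v \<in> ?V. \<Sum>j \<in> covers P i. idle_val P (xvar s v) j t)"
      using link(2) i tP A_diff[OF t] by fastforce
    then obtain v where v: "v \<in> ?V" "0 < (\<Sum>j \<in> covers P i. idle_val P (xvar s v) j t)"
      by (rule sum_pos_obtain)
    from v(2) obtain j where j: "j \<in> covers P i" "0 < idle_val P (xvar s v) j t"
      by (rule sum_pos_obtain)
    then have "t + 1 \<in> tperiods P" "j \<in> locations (emitting P)"
      using jobD(1)[OF i] by (auto simp: idle_val_def split: if_splits)
    with j r(2)[OF v(1), of "idle j t"] tP have "idle j t \<in> set (r v)"
      by (auto simp: idle_val_def E.idle_in_arcs_iff path_flow_def split: if_splits)
    then show ?thesis using v(1) j(1) by (auto simp: gcov_def)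
  qed
  have A_interval: "\<exists>a b. A i = {a..<b}" if i: "i \<in> jobs P" for i
  proof (rule convex_nat_interval)
    fix a b t assume ab: "a \<in> A i" "b \<in> A i" "a \<le> t" "t \<le> b"
    then have tP: "a \<in> tperiods P" "b \<in> tperiods P" "t \<in> tperiods P" by (auto simp: A_def periods_def)
    \<comment> \<open>At \<open>t\<close> the start variable is at least its value 1 at
      \<open>a\<close>, and the end variable is at most its value 0 at \<open>b\<close>.\<close>
    have "ySvar s i a \<le> ySvar s i t"
      by (rule mono_on_periods[OF _ ab(3) tP(3)]) (use y(2) i in blast)
    moreover have "yEvar s i t \<le> yEvar s i b"
      by (rule mono_on_periods[OF _ ab(4) tP(2)]) (use y(2) i in blast)
    moreover have "ySvar s i t \<in> {0, 1}" "yEvar s i t \<in> {0, 1}" using y(1) i tP(3) by blast+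
    ultimately show "t \<in> A i" using tP(3) ab(1,2) by (auto simp: A_def)
  qed (simp add: A_def)
  have A_card: "workload P i \<le> card (A i)" if i: "i \<in> jobs P" for i
  proof -
    have "real (workload P i) \<le> (\<Sum>t \<in> tperiods P. ySvar s i t - yEvar s i t)"
      using y(5) i by blast
    \<comment> \<open>Off \<open>A i\<close> the binary difference is 0 or -1.\<close>
    also have "\<dots> \<le> (\<Sum>t \<in> tperiods P. if t \<in> A i then 1 else 0)"
      using y(1) i by (intro sum_mono) (force simp: A_def)
    also have "\<dots> = real (card (A i))"
      by (simp add: sum.If_cases A_def Int_def)
    finally show ?thesis by simp
  qed
  have A_window: "A i \<subseteq> {wstart P i..<wend P i}" if i: "i \<in> jobs P" for i
    using y(3,4) i by (force simp: A_def not_le[symmetric])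

  define q where "q u = (p u, {(i, t). i \<in> jobs P \<and> visits (p u) i \<and> t \<in> A i})" for u
  have q_path: "q u \<in> ?Q" if u: "u \<in> ?U" for u
  proof -
    \<comment> \<open>Some vehicle idles at \<open>i\<close> in period \<open>t\<close> and
      therefore visits \<open>i\<close>; the visitor is unique, so this vehicle is
      \<open>u\<close>.\<close>
    have "idle i t \<in> set (p u)" if "i \<in> jobs P" "visits (p u) i" "t \<in> A i" for i t
      using visitor[OF that(1)] A_idle[OF that(1,3)] M.depot_path_idle(4)[OF p(1)] u that(2) by metis
    moreover have "card {a \<in> set (p u). a \<in> travel (mission P) \<and> fst (snd a) = i} \<le> 1" if "i \<in> jobs P" for i
      using visitor[OF that] u by (auto simp: entry_arcs_def Int_def)
    moreover have "{(i, t). i \<in> jobs P \<and> visits (p u) i \<and> t \<in> A i} `` {i} = A i"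
      if "i \<in> jobs P" "visits (p u) i" for i using that by auto
    ultimately show ?thesis
      using p(1)[OF u] A_interval A_card A_window unfolding q_def mission_paths_def by auto
  qed
  define s' where "s' = \<lparr>zbar = \<lambda>x. of_bool (x \<in> q ` ?U), xbar = \<lambda>x. of_bool (x \<in> r ` ?V)\<rparr>"
  have fields: "zbar s' = (\<lambda>x. of_bool (x \<in> q ` ?U))" "xbar s' = (\<lambda>x. of_bool (x \<in> r ` ?V))"
    by (simp_all add: s'_def)
  have qQ: "q ` ?U \<subseteq> ?Q" and rR: "r ` ?V \<subseteq> ?R"
    using q_path r(1) by (auto simp: emitting_paths_def)
  have Qi_one: "(\<Sum>x \<in> mission_paths_of P i. zbar s' x) = 1" if i: "i \<in> jobs P" for i
  proof -
    obtain u where u: "u \<in> ?U" "visits (p u) i" "\<forall>u' \<in> ?U. visits (p u') i \<longrightarrow> u' = u"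
      using visitor[OF i] by blast
    have "x = q u" if "x \<in> mission_paths_of P i" "x \<in> q ` ?U" for x
      using that u(3) by (auto simp: mission_paths_of_def q_def)
    then have "x \<in> q ` ?U \<longleftrightarrow> x = q u" if "x \<in> mission_paths_of P i" for x
      using that u(1) by blast
    then have "(\<Sum>x \<in> mission_paths_of P i. zbar s' x) =
        (\<Sum>x \<in> mission_paths_of P i. if x = q u then 1 else 0)"
      by (intro sum.cong) (simp_all only: fields of_bool_def)
    also have "\<dots> = 1"
      using u(2) q_path[OF u(1)] by (simp add: mission_paths_of_def q_def)
    finally show ?thesis .
  qed
  have fleet: "(\<Sum>x \<in> ?Q. zbar s' x) \<le> real (nmission P)" "(\<Sum>x \<in> ?R. xbar s' x) \<le> real (nemitting P)"
    using sum_image_indicator_le[OF finite_mpaths _ qQ, of "\<lambda>_. 1"]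
      sum_image_indicator_le[OF finite_epaths _ rR, of "\<lambda>_. 1"] by (simp_all add: fields)
  have cover: "(\<Sum>x \<in> ?Q. delta x i t * zbar s' x) \<le> (\<Sum>x \<in> ?R. gcov P x i t * xbar s' x)"
    if i: "i \<in> jobs P" for i t
  \<comment> \<open>In a working period the left side is at most the total weight 1 of the paths of
    the job, and one covering tour already yields 1. In other periods no selected path works on
    \<open>i\<close>.\<close>
  proof (cases "t \<in> A i")
    case True
    have "(\<Sum>x \<in> ?Q. delta x i t * zbar s' x) \<le> (\<Sum>x \<in> mission_paths_of P i. zbar s' x)"
      unfolding sum_delta_paths_of by (intro sum_mono) (auto simp: delta_def fields)
    also have "\<dots> = 1" by (rule Qi_one[OF i])
    also obtain v where v: "v \<in> ?V" "gcov P (r v) i t = 1" using A_cov[OF i True] by blast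
    then have "1 = gcov P (r v) i t * xbar s' (r v)" by (simp add: fields)
    also have "\<dots> \<le> (\<Sum>x \<in> ?R. gcov P x i t * xbar s' x)"
      using v(1) rR by (intro member_le_sum) (auto simp: gcov_def fields)
    finally show ?thesis .
  next
    case False
    then have "(\<Sum>x \<in> ?Q. delta x i t * zbar s' x) = 0"
      by (intro sum.neutral) (auto simp: delta_def fields q_def)
    moreover have "0 \<le> (\<Sum>x \<in> ?R. gcov P x i t * xbar s' x)"
      by (intro sum_nonneg) (auto simp: gcov_def fields)
    ultimately show ?thesis by simp
  qed
  have "s' \<in> SP_IP P"
    using Qi_one fleet cover by (simp add: sp_feasible_def) (simp add: fields)
  moreover have "sp_cost P s' \<le> ex_cost P s"
  proof -
    have "(\<Sum>x \<in> ?Q. path_cost (mission P) (fst x) * zbar s' x) \<le>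
        (\<Sum>u \<in> ?U. path_cost (mission P) (fst (q u)))"
      unfolding fields using qQ mission_pathsD(1) M.path_cost_nonneg
      by (intro sum_image_indicator_le) auto
    also have "\<dots> = (\<Sum>u \<in> ?U. \<Sum>a \<in> arcs (mnet P). acost (mission P) a * zvar s u a)"
      using M.path_cost_conv[OF p(1)] p(2) by (intro sum.cong) (simp_all add: q_def)
    finally have mission: "(\<Sum>x \<in> ?Q. path_cost (mission P) (fst x) * zbar s' x) \<le> \<dots>" .
    have "(\<Sum>x \<in> ?R. path_cost (emitting P) x * xbar s' x) \<le> (\<Sum>v \<in> ?V. path_cost (emitting P) (r v))"
      unfolding fields using rR r(1) E.path_cost_nonneg
      by (intro sum_image_indicator_le) auto
    also have "\<dots> = (\<Sum>v \<in> ?V. \<Sum>a \<in> arcs (enet P). acost (emitting P) a * xvar s v a)"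
      using E.path_cost_conv[OF r(1)] r(2) by (intro sum.cong) simp_all
    finally show ?thesis using mission by (simp add: sp_cost_def ex_cost_def)
  qed
  ultimately show ?thesis by blast
qed

end

lemma opt_value_le:
  assumes "\<And>s. s \<in> F \<Longrightarrow> \<exists>s' \<in> F'. c' s' \<le> c s"
  shows "opt_value F' c' \<le> opt_value F c"
  unfolding opt_value_def using assms by (intro INF_mono) simp

lemma formulations_compared:
  assumes "valid_instance P"
  shows "EX_IP P \<noteq> {} \<longleftrightarrow> SP_IP P \<noteq> {}"
    "opt_value (EX_IP P) (ex_cost P) = opt_value (SP_IP P) (sp_cost P)"
    "opt_value (EX_LP P) (ex_cost P) \<le> opt_value (SP_LP P) (sp_cost P)"
proof -
  interpret instance_jevrp P by unfold_locales (rule assms)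
  have int: "\<exists>s' \<in> EX_IP P. ex_cost P s' = sp_cost P s" if "s \<in> SP_IP P" for s
    using sp_to_ex[OF _ that] by (simp add: domain_pair_def)
  have lin: "\<exists>s' \<in> EX_LP P. ex_cost P s' = sp_cost P s" if "s \<in> SP_LP P" for s
    using sp_to_ex[OF _ that] by (simp add: domain_pair_def)
  show "EX_IP P \<noteq> {} \<longleftrightarrow> SP_IP P \<noteq> {}"
    using ex_to_sp int by blast
  show "opt_value (EX_IP P) (ex_cost P) = opt_value (SP_IP P) (sp_cost P)"
    using ex_to_sp int by (intro antisym opt_value_le) (metis order_refl)+
  show "opt_value (EX_LP P) (ex_cost P) \<le> opt_value (SP_LP P) (sp_cost P)"
    using lin by (intro opt_value_le) (metis order_refl)
qed

section \<open>An instance with a strict gap\<close>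

text \<open>
  A route leaves job 1 either at once, without working there, or at time 3, reaching job 2 only after
  its time window; so no route can work on both jobs, although it visits both. (EX) does not tie the
  work on a job to the vehicles: half a vehicle on each of \<open>gap_route1\<close> (two idle periods at
  job 1) and \<open>gap_route2\<close> (two idle periods at job 2) suffices.
\<close>

definition gap_mission :: tsnet where
  "gap_mission = \<lparr>nlocs = 2,
     travel = {((0, 0), (1, 1)), ((1, 1), (2, 2)), ((1, 3), (2, 4)), ((2, 4), (3, 5)), ((0, 0), (3, 5))},
     acost = \<lambda>_. 0\<rparr>"

text \<open>A single tour can idle through periods 1, 2 and 3, the union of both time windows, so
  the emitting side is not the bottleneck.\<close>

definition gap_emitting :: tsnet where
  "gap_emitting = \<lparr>nlocs = 1,
     travel = {((0, 0), (1, 1)), ((1, 4), (2, 5)), ((0, 0), (2, 5))}, acost = \<lambda>_. 0\<rparr>"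

text \<open>The window of job \<open>i\<close> consists of the periods \<open>i\<close> and
  \<open>i + 1\<close>: two periods are what half a vehicle needs for one unit of work, and job 2 is
  closed from time 4 on.\<close>

definition gap_instance :: jevrp where
  "gap_instance = \<lparr>horizon = 4, mission = gap_mission, emitting = gap_emitting,
     covers = \<lambda>_. {1}, nmission = 1, nemitting = 1,
     workload = \<lambda>_. 1, wstart = \<lambda>i. i, wend = \<lambda>i. i + 2\<rparr>"

definition gap_route1 :: "tsarc list" where
  "gap_route1 = [((0, 0), (1, 1)), idle 1 1, idle 1 2, ((1, 3), (2, 4)), ((2, 4), (3, 5))]"

definition gap_route2 :: "tsarc list" where
  "gap_route2 = [((0, 0), (1, 1)), ((1, 1), (2, 2)), idle 2 2, idle 2 3, ((2, 4), (3, 5))]"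

definition gap_tour :: "tsarc list" where
  "gap_tour = [((0, 0), (1, 1)), idle 1 1, idle 1 2, idle 1 3, ((1, 4), (2, 5))]"

lemma gap_instance_sel [simp]:
  "horizon gap_instance = 4" "mission gap_instance = gap_mission" "emitting gap_instance = gap_emitting"
  "covers gap_instance i = {1}" "nmission gap_instance = 1" "nemitting gap_instance = 1"
  "workload gap_instance i = 1" "wstart gap_instance i = i" "wend gap_instance i = i + 2"
  by (simp_all add: gap_instance_def)

lemma gap_locations [simp]: "locations gap_mission = {1, 2}" "locations gap_emitting = {1}"
  by (auto simp: locations_def gap_mission_def gap_emitting_def)

lemma gap_periods: "periods 4 = {0, 1, 2, 3, 4, 5}"
  by (auto simp: periods_def)

lemma valid_gap_instance: "valid_instance gap_instance"
  by (auto simp: valid_instance_def valid_tsnet_def direct_arc_def periods_def)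
    (auto simp: gap_mission_def gap_emitting_def)

interpretation gap: instance_jevrp gap_instance
  by unfold_locales (rule valid_gap_instance)

section \<open>Arcs, routes and flow balance of the instance\<close>

lemma idle_ends: "fst (idle i t) = (i, t)" "snd (idle i t) = (i, t + 1)"
  by (simp_all add: idle_def)

lemma gap_arcs:
  "((0, 0), (1, 1)) \<in> arcs (network 4 gap_mission)" "((1, 1), (2, 2)) \<in> arcs (network 4 gap_mission)"
  "((1, 3), (2, 4)) \<in> arcs (network 4 gap_mission)" "((2, 4), (3, 5)) \<in> arcs (network 4 gap_mission)"
  "((0, 0), (1, 1)) \<in> arcs (network 4 gap_emitting)" "((1, 4), (2, 5)) \<in> arcs (network 4 gap_emitting)"
  by (simp_all add: arcs_network gap_mission_def gap_emitting_def)

lemma gap_idle_arcs: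
  "idle i t \<in> arcs (network 4 gap_mission) \<longleftrightarrow> i \<in> {1, 2} \<and> t \<le> 4"
  "idle i t \<in> arcs (network 4 gap_emitting) \<longleftrightarrow> i = 1 \<and> t \<le> 4"
  using gap.M.idle_in_arcs_iff[of i t] gap.E.idle_in_arcs_iff[of i t]
  by (auto simp: periods_def)

lemma gap_depot_paths:
  "depot_path 4 gap_mission gap_route1" "depot_path 4 gap_mission gap_route2"
  "depot_path 4 gap_emitting gap_tour"
proof -
  have n: "nlocs gap_mission = 2" "nlocs gap_emitting = 1"
    by (simp_all add: gap_mission_def gap_emitting_def)
  have "pre_digraph.cas (network 4 gap_mission) (0, 0) gap_route1 (nlocs gap_mission + 1, 5)"
    "pre_digraph.cas (network 4 gap_mission) (0, 0) gap_route2 (nlocs gap_mission + 1, 5)"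
    "pre_digraph.cas (network 4 gap_emitting) (0, 0) gap_tour (nlocs gap_emitting + 1, 5)"
    by (simp_all add: gap_route1_def gap_route2_def gap_tour_def n idle_ends pre_digraph.cas.simps)
  moreover have "set gap_route1 \<subseteq> arcs (network 4 gap_mission)"
    "set gap_route2 \<subseteq> arcs (network 4 gap_mission)" "set gap_tour \<subseteq> arcs (network 4 gap_emitting)"
    by (simp_all add: gap_route1_def gap_route2_def gap_tour_def gap_arcs[simplified] gap_idle_arcs)
  moreover have "0 \<in> periods 4" "5 \<in> periods 4" by (simp_all add: periods_def)
  ultimately show "depot_path 4 gap_mission gap_route1" "depot_path 4 gap_mission gap_route2"
    "depot_path 4 gap_emitting gap_tour"
    using gap.M.depot_path_iff gap.E.depot_path_iff unfolding gap_instance_sel by blast+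
qed

lemma gap_balance:
  assumes "depot_path 4 gap_mission p"
  shows "path_flow p (idle 1 1) = path_flow p (idle 1 2)"
    "path_flow p (idle 1 2) = path_flow p ((1, 3), (2, 4))"
    "path_flow p ((0, 0), (1, 1)) = path_flow p ((1, 1), (2, 2)) + path_flow p (idle 1 1)"
    "path_flow p ((1, 1), (2, 2)) = path_flow p (idle 2 2)"
    "path_flow p (idle 2 2) = path_flow p (idle 2 3)"
proof -
  let ?G = "network 4 gap_mission"
  have arcs: "a \<in> arcs ?G \<longleftrightarrow> (\<exists>i \<in> {1, 2}. \<exists>t \<in> {0, 1, 2, 3, 4}. a = idle i t) \<or>
      a \<in> {((0, 0), (1, 1)), ((1, 1), (2, 2)), ((1, 3), (2, 4)), ((2, 4), (3, 5)), ((0, 0), (3, 5))}" for a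
    by (auto simp: arcs_network gap_mission_def locations_def periods_def numeral_eq_Suc less_Suc_eq_le le_Suc_eq)
  have in_arcs:
    "in_arcs ?G (1, 0) = {}" "in_arcs ?G (1, 1) = {((0, 0), (1, 1)), idle 1 0}"
    "in_arcs ?G (1, 2) = {idle 1 1}" "in_arcs ?G (1, 3) = {idle 1 2}"
    "in_arcs ?G (1, 4) = {idle 1 3}" "in_arcs ?G (1, 5) = {idle 1 4}"
    "in_arcs ?G (2, 0) = {}" "in_arcs ?G (2, 1) = {idle 2 0}"
    "in_arcs ?G (2, 2) = {((1, 1), (2, 2)), idle 2 1}" "in_arcs ?G (2, 3) = {idle 2 2}"
    unfolding in_arcs_def arcs by (auto simp: idle_def)
  have out_arcs:
    "out_arcs ?G (1, 0) = {idle 1 0}" "out_arcs ?G (1, 1) = {((1, 1), (2, 2)), idle 1 1}"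
    "out_arcs ?G (1, 2) = {idle 1 2}" "out_arcs ?G (1, 3) = {((1, 3), (2, 4)), idle 1 3}"
    "out_arcs ?G (1, 4) = {idle 1 4}" "out_arcs ?G (1, 5) = {}"
    "out_arcs ?G (2, 0) = {idle 2 0}" "out_arcs ?G (2, 1) = {idle 2 1}"
    "out_arcs ?G (2, 2) = {idle 2 2}" "out_arcs ?G (2, 3) = {idle 2 3}"
    unfolding out_arcs_def arcs by (auto simp: idle_def)
  have "vehicle_flow {0, 1} 4 gap_mission (path_flow p)"
    using gap.M.depot_path_flow assms by simp
  note balance = vehicle_flowD(4)[OF this]
  have ne: "((0, 0), (1, 1)) \<noteq> idle 1 0" "((1, 1), (2, 2)) \<noteq> idle 1 1"
    "((1, 1), (2, 2)) \<noteq> idle 2 1" "((1, 3), (2, 4)) \<noteq> idle 1 3"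
    by (auto simp: idle_def)
  \<comment> \<open>Balance at \<open>(1, 0)\<close>, \<open>(2, 0)\<close> and
    \<open>(2, 1)\<close> rules out idling before any arrival, and at \<open>(1, 4)\<close> and
    \<open>(1, 5)\<close> idling at job 1 after the last departure. The remaining nodes then give
    the claimed equations.\<close>
  note b = balance[of "(1, 0)"] balance[of "(1, 1)"] balance[of "(1, 2)"] balance[of "(1, 3)"]
    balance[of "(1, 4)"] balance[of "(1, 5)"] balance[of "(2, 0)"] balance[of "(2, 1)"]
    balance[of "(2, 2)"] balance[of "(2, 3)"]
  show "path_flow p (idle 1 1) = path_flow p (idle 1 2)"
    "path_flow p (idle 1 2) = path_flow p ((1, 3), (2, 4))"
    "path_flow p ((0, 0), (1, 1)) = path_flow p ((1, 1), (2, 2)) + path_flow p (idle 1 1)"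
    "path_flow p ((1, 1), (2, 2)) = path_flow p (idle 2 2)"
    "path_flow p (idle 2 2) = path_flow p (idle 2 3)"
    using b unfolding in_arcs out_arcs by (simp_all add: gap_periods ne del: One_nat_def)
qed

lemma gap_work:
  assumes "q \<in> mission_paths gap_instance" "visits (fst q) i" "i \<in> {1, 2}"
  shows "idle i i \<in> set (fst q) \<or> idle i (i + 1) \<in> set (fst q)"
proof -
  have q: "q \<in> mission_paths_of gap_instance i" "i \<in> jobs gap_instance"
    using assms by (auto simp: mission_paths_of_def)
  then have "snd q `` {i} \<noteq> {}"
    using gap.mission_path_work(2)[OF q] by auto
  then obtain t where t: "(i, t) \<in> snd q" by auto
  then have "t = i \<or> t = i + 1"
    using gap.mission_path_work(3)[OF q] by fastforce
  then show ?thesis using gap.mission_path_work(4)[OF q t] by auto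
qed

lemma gap_no_mission_path: "mission_paths_of gap_instance 1 = {}"
proof (rule equals0I)
  fix q assume q: "q \<in> mission_paths_of gap_instance 1"
  then have qP: "q \<in> mission_paths gap_instance" and vis: "visits (fst q) 1"
    by (auto simp: mission_paths_of_def)
  note balance = gap_balance[OF gap.mission_pathsD(1)[OF qP, simplified]]
  \<comment> \<open>Work on job 1 is compulsory in period 1 or 2, and the two idle arcs carry equal
    flow.\<close>
  have "path_flow (fst q) (idle 1 1) = 1"
    using gap_work[OF qP vis] balance(1) by (auto simp: path_flow_def numeral_2_eq_2)
  moreover have "path_flow (fst q) ((0, 0), (1, 1)) \<le> 1" "0 \<le> path_flow (fst q) ((1, 1), (2, 2))"
    by (simp_all add: path_flow_def)
  \<comment> \<open>The flow into job 1 is at most 1, so idling there leaves nothing for the early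
    departure to job 2.\<close>
  ultimately have "path_flow (fst q) ((1, 3), (2, 4)) = 1" "path_flow (fst q) (idle 2 2) = 0"
    "path_flow (fst q) (idle 2 3) = 0"
    using balance by linarith+
  then have "((1, 3), (2, 4)) \<in> set (fst q)" "idle 2 2 \<notin> set (fst q)" "idle 2 3 \<notin> set (fst q)"
    by (auto simp: path_flow_def)
  \<comment> \<open>The late departure still visits job 2, which makes work there compulsory as
    well.\<close>
  moreover from this(1) have "visits (fst q) 2" by (force simp: visits_def)
  ultimately show False using gap_work[OF qP, of 2] by simp
qed

text \<open>The partitioning constraint of job 1 reads 0 = 1, even for fractional weights.\<close>

lemma gap_SP_infeasible: "SP_LP gap_instance = {}"
proof -
  have "s \<notin> SP_LP gap_instance" for s
    using gap_no_mission_path by (auto simp: sp_feasible_def)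
  then show ?thesis by blast
qed

text \<open>Both routes enter both jobs, so the halves add up to one entry per job, while each job
  gets its idle time from one route only. The start variable reaches 1/2 at \<open>i\<close>, and
  both variables reach 1 at \<open>i + 2\<close>; the difference is 1/2 in exactly the two periods
  in which half a vehicle idles at the job.\<close>

definition gap_point :: ex_point where
  "gap_point = \<lparr>
     zvar = \<lambda>_ a. \<Sum>p \<in> {gap_route1, gap_route2}. 1 / 2 * path_flow p a,
     xvar = \<lambda>_. path_flow gap_tour,
     ySvar = \<lambda>i t. if t < i then 0 else if t < i + 2 then 1 / 2 else 1,
     yEvar = \<lambda>i t. if t < i + 2 then 0 else 1\<rparr>"

lemma gap_routes_distinct: "gap_route1 \<noteq> gap_route2"
  by (simp add: gap_route1_def gap_route2_def idle_def)

lemma gap_EX_feasible: "gap_point \<in> EX_LP gap_instance"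
proof -
  let ?z = "\<lambda>a. \<Sum>p \<in> {gap_route1, gap_route2}. 1 / 2 * path_flow p a"
  have z: "vehicle_flow {0..1} 4 gap_mission ?z"
    using gap.M.mixture_flow[of "{0..}" "{0..1}" "{gap_route1, gap_route2}" id "\<lambda>_. 1 / 2"]
      gap_depot_paths gap_routes_distinct
    by (auto simp: domain_pair_def)
  have x: "vehicle_flow {0..1} 4 gap_emitting (path_flow gap_tour)"
    using gap.E.mixture_flow[of "{0..}" "{0..1}" "{gap_tour}" id "\<lambda>_. 1"] gap_depot_paths
    by (auto simp: domain_pair_def)
  have z_eq: "?z a = (path_flow gap_route1 a + path_flow gap_route2 a) / 2" for a
    using gap_routes_distinct by simp
  have "entry_arcs gap_mission 1 = {((0, 0), (1, 1))}"
    "entry_arcs gap_mission 2 = {((1, 1), (2, 2)), ((1, 3), (2, 4))}"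
    by (auto simp: entry_arcs_def gap_mission_def)
  then have entry: "(\<Sum>a \<in> entry_arcs gap_mission i. ?z a) = 1" if "i \<in> {1, 2}" for i
    using that unfolding z_eq by (auto simp: path_flow_def gap_route1_def gap_route2_def idle_def)
  have idle: "idle_val gap_instance ?z i t = (if t = i \<or> t = i + 1 then 1 / 2 else 0)"
    if "i \<in> {1, 2}" for i t
    using that unfolding idle_val_def z_eq
    by (auto simp: gap_periods path_flow_def gap_route1_def gap_route2_def idle_def)
  have cover: "idle_val gap_instance (path_flow gap_tour) 1 t = (if t \<in> {1, 2, 3} then 1 else 0)" for t
    by (auto simp: idle_val_def gap_periods path_flow_def gap_tour_def idle_def)
  show ?thesis
    unfolding ex_feasible_def
    using z x entry gap.M.sum_entry_arcs[of ?z] idle cover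
    by (auto simp: gap_point_def gap_periods)
qed

lemma gap_strict:
  "opt_value (EX_LP gap_instance) (ex_cost gap_instance) <
   opt_value (SP_LP gap_instance) (sp_cost gap_instance)"
proof -
  have "opt_value (EX_LP gap_instance) (ex_cost gap_instance) \<le> ereal (ex_cost gap_instance gap_point)"
    unfolding opt_value_def using gap_EX_feasible by (rule INF_lower)
  also have "\<dots> < \<infinity>" by simp
  also have "\<infinity> = opt_value (SP_LP gap_instance) (sp_cost gap_instance)"
    by (simp add: opt_value_def gap_SP_infeasible top_ereal_def)
  finally show ?thesis .
qed

theorem proposition1:
  "(\<forall>P. valid_instance P \<longrightarrow>
      (EX_IP P \<noteq> {} \<longleftrightarrow> SP_IP P \<noteq> {}) \<and>
      opt_value (EX_IP P) (ex_cost P) = opt_value (SP_IP P) (sp_cost P) \<and>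
      opt_value (EX_LP P) (ex_cost P) \<le> opt_value (SP_LP P) (sp_cost P)) \<and>
   (\<exists>P. valid_instance P \<and>
      opt_value (EX_LP P) (ex_cost P) < opt_value (SP_LP P) (sp_cost P))"
  using formulations_compared valid_gap_instance gap_strict by blast

end
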